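(* Suppose $\dot\setminus$ is included in the signature $\sigma$ and all symbols in $\sigma$ are from $\{\dot\smile,\dot\setminus,\mid,\emptyset\}$. Then the class of partial algebras $\sigma$-representable by partial functions is not finitely axiomatisable in first-order logic. Moreover, the class of partial algebras $\lesssim'$-completely $\sigma$-representable by partial functions is not closed under elementary equivalence.
   Context: A partial function is a functional set of ordered pairs. For partial functions $f,g$, the domain-disjoint union $f\mathbin{\dot\smile}g$ equals $f\cup g$ if the domains of $f$ and $g$ are disjoint, and is undefined otherwise; the subset complement $f\mathbin{\dot\setminus}g$ equals $f\setminus g$ if $g\subseteq f$, and is undefined otherwise; $f\mid g$ denotes the (total operation of) composition of partial functions; $\emptyset$ denotes the constant empty function. A partial algebra is a (possibly empty) set together with a sequence of partial operations of finite arities. An isomorphism between similar partial algebras is a bijection $\theta$ such that for each operation $\Omega$ and corresponding operation $\Pi$, $\Omega(a_1,\dots,a_k)$ is defined if and only if $\Pi(\theta(a_1),\dots,\theta(a_k))$ is defined, and then $\theta(\Omega(a_1,\dots,a_k))=\Pi(\theta(a_1),\dots,\theta(a_k))$. A partial $\sigma$-algebra of partial functions is a set of partial functions closed under the partial and total operations in $\sigma$ wherever they are defined, and containing the empty set if $\emptyset$ is in $\sigma$. A $\sigma$-representation by partial functions of a partial algebra is an isomorphism from it to a partial $\sigma$-algebra of partial functions; a partial algebra is $\sigma$-representable by partial functions if it has one. The abstract symbols corresponding to $\dot\smile,\dot\setminus,\mid,\emptyset$ are $\dot\sqcup,\dot-,;,0$. In a partial algebra $\mathfrak A$ whose signature includes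 $\dot-$, define $a\lesssim' b$ iff $a=b$ or $b\mathbin{\dot-}a$ is defined (a partial order if $\mathfrak A$ is representable). A subset $S$ of $\mathfrak A$ is $\dot-$-pairwise-combinable if for all distinct $s,t\in S$ there is $u\in\mathfrak A$ such that $u\mathbin{\dot-}s$ is defined and equals $t$. A $\sigma$-representation $\theta$ is $\lesssim'$-complete if for every $\dot-$-pairwise-combinable subset $S$ of $\mathfrak A$ with a supremum $a$ with respect to $\lesssim'$ we have $a^\theta=\bigcup_{s\in S}s^\theta$. $\mathfrak A$ is $\lesssim'$-completely $\sigma$-representable if it has a $\lesssim'$-complete $\sigma$-representation. First-order notions refer to the relational view (with equality): $\dot\sqcup$ is encoded by a ternary relation symbol $J$, with $J(a,b,c)$ iff $a\mathbin{\dot\sqcup}b$ is defined and equal to $c$; $\dot-$ is encoded by a ternary relation symbol $K$, with $K(a,b,c)$ iff $a\mathbin{\dot-}b$ is defined and equal to $c$; $;$ is a binary function symbol and $0$ a constant symbol. *)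

theory Defs
  imports Main "HOL-Library.Countable_Set"
begin

section \<open>Partial algebras\<close>

datatype sym = DJoin | DMinus | Comp | Zero

text \<open>
  One record serves all signatures \<open>\<sigma> :: sym set\<close>: a field whose symbol is not in \<open>\<sigma>\<close> is never
  looked at, and operations only matter on the carrier, which may be empty.  The value \<open>None\<close>
  means ``undefined''.  As \<open>;\<close> and \<open>0\<close> are a function symbol and a constant symbol of the
  first-order language, their interpretations are total.
\<close>

record 'a palg =
  carrier :: "'a set"
  djoin :: "'a \<Rightarrow> 'a \<Rightarrow> 'a option"
  dminus :: "'a \<Rightarrow> 'a \<Rightarrow> 'a option"
  comp :: "'a \<Rightarrow> 'a \<Rightarrow> 'a"
  zero :: 'a

definition partial_algebra :: "sym set \<Rightarrow> 'a palg \<Rightarrow> bool" where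
  "partial_algebra \<sigma> A \<longleftrightarrow>
     (DJoin \<in> \<sigma> \<longrightarrow> (\<forall>a\<in>carrier A. \<forall>b\<in>carrier A. \<forall>c. djoin A a b = Some c \<longrightarrow> c \<in> carrier A)) \<and>
     (DMinus \<in> \<sigma> \<longrightarrow> (\<forall>a\<in>carrier A. \<forall>b\<in>carrier A. \<forall>c. dminus A a b = Some c \<longrightarrow> c \<in> carrier A)) \<and>
     (Comp \<in> \<sigma> \<longrightarrow> (\<forall>a\<in>carrier A. \<forall>b\<in>carrier A. comp A a b \<in> carrier A)) \<and>
     (Zero \<in> \<sigma> \<longrightarrow> zero A \<in> carrier A)"

text \<open>
  Since \<open>map_option \<theta> None = None\<close>, each equation between options says that one side is defined
  iff the other is, and that the values then correspond.
\<close>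

definition isomorphism :: "sym set \<Rightarrow> 'a palg \<Rightarrow> 'b palg \<Rightarrow> ('a \<Rightarrow> 'b) \<Rightarrow> bool" where
  "isomorphism \<sigma> A B \<theta> \<longleftrightarrow>
     bij_betw \<theta> (carrier A) (carrier B) \<and>
     (DJoin \<in> \<sigma> \<longrightarrow> (\<forall>a\<in>carrier A. \<forall>b\<in>carrier A.
        map_option \<theta> (djoin A a b) = djoin B (\<theta> a) (\<theta> b))) \<and>
     (DMinus \<in> \<sigma> \<longrightarrow> (\<forall>a\<in>carrier A. \<forall>b\<in>carrier A.
        map_option \<theta> (dminus A a b) = dminus B (\<theta> a) (\<theta> b))) \<and>
     (Comp \<in> \<sigma> \<longrightarrow> (\<forall>a\<in>carrier A. \<forall>b\<in>carrier A. \<theta> (comp A a b) = comp B (\<theta> a) (\<theta> b))) \<and>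
     (Zero \<in> \<sigma> \<longrightarrow> \<theta> (zero A) = zero B)"


section \<open>Representations by partial functions\<close>

type_synonym 'x pfun = "('x \<times> 'x) set"

definition dd_union :: "'x pfun \<Rightarrow> 'x pfun \<Rightarrow> 'x pfun option" where
  "dd_union f g = (if Domain f \<inter> Domain g = {} then Some (f \<union> g) else None)"

definition subset_compl :: "'x pfun \<Rightarrow> 'x pfun \<Rightarrow> 'x pfun option" where
  "subset_compl f g = (if g \<subseteq> f then Some (f - g) else None)"

definition pfun_palg :: "'x pfun set \<Rightarrow> 'x pfun palg" where
  "pfun_palg F = \<lparr>carrier = F, djoin = dd_union, dminus = subset_compl, comp = (O), zero = {}\<rparr>"

definition partial_algebra_of_pfuns :: "sym set \<Rightarrow> 'x pfun set \<Rightarrow> bool" where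
  "partial_algebra_of_pfuns \<sigma> F \<longleftrightarrow>
     (\<forall>f\<in>F. single_valued f) \<and> partial_algebra \<sigma> (pfun_palg F)"

definition representation :: "sym set \<Rightarrow> 'a palg \<Rightarrow> ('a \<Rightarrow> 'x pfun) \<Rightarrow> bool" where
  "representation \<sigma> A \<theta> \<longleftrightarrow>
     (\<exists>F. partial_algebra_of_pfuns \<sigma> F \<and> isomorphism \<sigma> A (pfun_palg F) \<theta>)"

definition lesssim :: "'a palg \<Rightarrow> 'a \<Rightarrow> 'a \<Rightarrow> bool" where
  "lesssim A a b \<longleftrightarrow> a = b \<or> dminus A b a \<noteq> None"

definition is_supremum :: "'a palg \<Rightarrow> 'a set \<Rightarrow> 'a \<Rightarrow> bool" where
  "is_supremum A S a \<longleftrightarrow>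
     a \<in> carrier A \<and> (\<forall>s\<in>S. lesssim A s a) \<and>
     (\<forall>b\<in>carrier A. (\<forall>s\<in>S. lesssim A s b) \<longrightarrow> lesssim A a b)"

definition pairwise_combinable :: "'a palg \<Rightarrow> 'a set \<Rightarrow> bool" where
  "pairwise_combinable A S \<longleftrightarrow>
     (\<forall>s\<in>S. \<forall>t\<in>S. s \<noteq> t \<longrightarrow> (\<exists>u\<in>carrier A. dminus A u s = Some t))"

definition complete_representation :: "sym set \<Rightarrow> 'a palg \<Rightarrow> ('a \<Rightarrow> 'x pfun) \<Rightarrow> bool" where
  "complete_representation \<sigma> A \<theta> \<longleftrightarrow>
     representation \<sigma> A \<theta> \<and>
     (\<forall>S a. S \<subseteq> carrier A \<longrightarrow> pairwise_combinable A S \<longrightarrow> is_supremum A S a \<longrightarrow>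
        \<theta> a = (\<Union>s\<in>S. \<theta> s))"

text \<open>
  A representation may use any base set.  The two definitions below have to name a base type, and
  take \<open>'a + nat\<close>, which is infinite and at least as large as the algebra; the lemmas
  \<open>representableI\<close> and \<open>completely_representableI\<close> at the end of the theory show that
  a (complete) representation over any base type whatsoever yields one over \<open>'a + nat\<close>, so
  nothing is lost.
\<close>

definition representable :: "sym set \<Rightarrow> 'a palg \<Rightarrow> bool" where
  "representable \<sigma> A \<longleftrightarrow> (\<exists>\<theta> :: 'a \<Rightarrow> ('a + nat) pfun. representation \<sigma> A \<theta>)"

definition completely_representable :: "sym set \<Rightarrow> 'a palg \<Rightarrow> bool" where
  "completely_representable \<sigma> A \<longleftrightarrow>
     (\<exists>\<theta> :: 'a \<Rightarrow> ('a + nat) pfun. complete_representation \<sigma> A \<theta>)"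


section \<open>First-order logic\<close>

datatype tm = Var nat | ZeroT | CompT tm tm

datatype fm =
    Eq tm tm
  | J tm tm tm
  | K tm tm tm
  | Neg fm
  | Conj fm fm
  | Ex nat fm

primrec tm_syms :: "tm \<Rightarrow> sym set" where
  "tm_syms (Var n) = {}"
| "tm_syms ZeroT = {Zero}"
| "tm_syms (CompT s t) = {Comp} \<union> tm_syms s \<union> tm_syms t"

primrec fm_syms :: "fm \<Rightarrow> sym set" where
  "fm_syms (Eq s t) = tm_syms s \<union> tm_syms t"
| "fm_syms (J s t u) = {DJoin} \<union> tm_syms s \<union> tm_syms t \<union> tm_syms u"
| "fm_syms (K s t u) = {DMinus} \<union> tm_syms s \<union> tm_syms t \<union> tm_syms u"
| "fm_syms (Neg p) = fm_syms p"
| "fm_syms (Conj p q) = fm_syms p \<union> fm_syms q"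
| "fm_syms (Ex n p) = fm_syms p"

primrec tm_fvs :: "tm \<Rightarrow> nat set" where
  "tm_fvs (Var n) = {n}"
| "tm_fvs ZeroT = {}"
| "tm_fvs (CompT s t) = tm_fvs s \<union> tm_fvs t"

primrec fm_fvs :: "fm \<Rightarrow> nat set" where
  "fm_fvs (Eq s t) = tm_fvs s \<union> tm_fvs t"
| "fm_fvs (J s t u) = tm_fvs s \<union> tm_fvs t \<union> tm_fvs u"
| "fm_fvs (K s t u) = tm_fvs s \<union> tm_fvs t \<union> tm_fvs u"
| "fm_fvs (Neg p) = fm_fvs p"
| "fm_fvs (Conj p q) = fm_fvs p \<union> fm_fvs q"
| "fm_fvs (Ex n p) = fm_fvs p - {n}"

definition sentence :: "sym set \<Rightarrow> fm \<Rightarrow> bool" where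
  "sentence \<sigma> p \<longleftrightarrow> fm_syms p \<subseteq> \<sigma> \<and> fm_fvs p = {}"

primrec tm_val :: "'a palg \<Rightarrow> (nat \<Rightarrow> 'a) \<Rightarrow> tm \<Rightarrow> 'a" where
  "tm_val A e (Var n) = e n"
| "tm_val A e ZeroT = zero A"
| "tm_val A e (CompT s t) = comp A (tm_val A e s) (tm_val A e t)"

primrec sat :: "'a palg \<Rightarrow> (nat \<Rightarrow> 'a) \<Rightarrow> fm \<Rightarrow> bool" where
  "sat A e (Eq s t) \<longleftrightarrow> tm_val A e s = tm_val A e t"
| "sat A e (J s t u) \<longleftrightarrow> djoin A (tm_val A e s) (tm_val A e t) = Some (tm_val A e u)"
| "sat A e (K s t u) \<longleftrightarrow> dminus A (tm_val A e s) (tm_val A e t) = Some (tm_val A e u)"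
| "sat A e (Neg p) \<longleftrightarrow> \<not> sat A e p"
| "sat A e (Conj p q) \<longleftrightarrow> sat A e p \<and> sat A e q"
| "sat A e (Ex n p) \<longleftrightarrow> (\<exists>a\<in>carrier A. sat A (e(n := a)) p)"

text \<open>
  Only used for sentences, whose truth does not depend on the assignment.  Quantifying over all
  assignments into the type, rather than into the carrier, gives the right meaning in the empty
  structure too.
\<close>

definition models :: "'a palg \<Rightarrow> fm \<Rightarrow> bool" (infix "\<Turnstile>" 50) where
  "A \<Turnstile> p \<longleftrightarrow> (\<forall>e. sat A e p)"

definition elementarily_equivalent :: "sym set \<Rightarrow> 'a palg \<Rightarrow> 'a palg \<Rightarrow> bool" where
  "elementarily_equivalent \<sigma> A B \<longleftrightarrow> (\<forall>p. sentence \<sigma> p \<longrightarrow> (A \<Turnstile> p \<longleftrightarrow> B \<Turnstile> p))"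

text \<open>
  The classes below consist of the partial algebras whose carriers are subsets of the type \<open>'a\<close>.
  A finite axiomatisation of a class of arbitrary partial algebras restricts to one of its members
  with carrier in \<open>'a\<close>, and closure under elementary equivalence restricts in the same way, so
  that refuting either property for a given \<open>'a\<close> refutes it for arbitrary partial algebras.
  A converse needs \<open>'a\<close> to be large enough: over a finite type, for instance, every class closed
  under isomorphism is finitely axiomatisable.
\<close>

definition finitely_axiomatisable :: "sym set \<Rightarrow> 'a palg set \<Rightarrow> bool" where
  "finitely_axiomatisable \<sigma> C \<longleftrightarrow>
     (\<exists>\<Phi>. finite \<Phi> \<and> (\<forall>p\<in>\<Phi>. sentence \<sigma> p) \<and>
        (\<forall>A. partial_algebra \<sigma> A \<longrightarrow> (A \<in> C \<longleftrightarrow> (\<forall>p\<in>\<Phi>. A \<Turnstile> p))))"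

definition closed_under_elementary_equivalence :: "sym set \<Rightarrow> 'a palg set \<Rightarrow> bool" where
  "closed_under_elementary_equivalence \<sigma> C \<longleftrightarrow>
     (\<forall>A B. partial_algebra \<sigma> A \<longrightarrow> partial_algebra \<sigma> B \<longrightarrow>
        elementarily_equivalent \<sigma> A B \<longrightarrow> A \<in> C \<longrightarrow> B \<in> C)"

definition representable_class :: "sym set \<Rightarrow> 'a palg set" where
  "representable_class \<sigma> = {A. partial_algebra \<sigma> A \<and> representable \<sigma> A}"

definition completely_representable_class :: "sym set \<Rightarrow> 'a palg set" where
  "completely_representable_class \<sigma> = {A. partial_algebra \<sigma> A \<and> completely_representable \<sigma> A}"


section \<open>The choice of base type is immaterial\<close>

lemma infinite_sum_nat: "infinite (UNIV :: ('a + nat) set)"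
  by (simp add: finite_Plus_UNIV_iff)

lemma card_of_Image_single_valued:
  includes cardinal_syntax
  assumes "single_valued f"
  shows "|f `` X| \<le>o |X|"
proof -
  have "f `` X \<subseteq> (\<lambda>x. THE y. (x, y) \<in> f) ` X"
  proof
    fix y assume "y \<in> f `` X"
    then obtain x where x: "x \<in> X" "(x, y) \<in> f" by blast
    have "(THE y. (x, y) \<in> f) = y"
      using x(2) assms by (auto dest: single_valuedD)
    then show "y \<in> (\<lambda>x. THE y. (x, y) \<in> f) ` X" using x(1) by force
  qed
  then show ?thesis
    by (meson card_of_image card_of_mono1 ordLeq_transitive)
qed

lemma small_closed_superset:
  includes cardinal_syntax
  fixes \<theta> :: "'a \<Rightarrow> 'x pfun"
  assumes sv: "\<And>a. a \<in> C \<Longrightarrow> single_valued (\<theta> a)"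
    and W: "|W :: 'x set| \<le>o |UNIV :: ('a + nat) set|"
  shows "\<exists>X. W \<subseteq> X \<and> (\<forall>a\<in>C. \<theta> a `` X \<subseteq> X) \<and> |X| \<le>o |UNIV :: ('a + nat) set|"
proof (intro exI conjI ballI)
  define step where "step Y = (\<Union>a\<in>C. \<theta> a `` Y)" for Y
  let ?X = "\<Union>n. (step ^^ n) W"
  have C: "|C| \<le>o |UNIV :: ('a + nat) set|"
    by (rule card_of_ordLeqI[where f = Inl]) auto
  have le: "|(step ^^ n) W| \<le>o |UNIV :: ('a + nat) set|" for n
  proof (induction n)
    case 0 then show ?case using W by simp
  next
    case (Suc n)
    have "|\<theta> a `` ((step ^^ n) W)| \<le>o |UNIV :: ('a + nat) set|" if "a \<in> C" for a
      using card_of_Image_single_valued[OF sv[OF that]] Suc ordLeq_transitive by blast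
    then have "|step ((step ^^ n) W)| \<le>o |UNIV :: ('a + nat) set|"
      unfolding step_def by (intro card_of_UNION_ordLeq_infinite[OF infinite_sum_nat C] ballI)
    then show ?case by simp
  qed
  have "|UNIV :: nat set| \<le>o |UNIV :: ('a + nat) set|"
    by (rule card_of_ordLeqI[where f = Inr]) auto
  then show "|?X| \<le>o |UNIV :: ('a + nat) set|"
    by (intro card_of_UNION_ordLeq_infinite[OF infinite_sum_nat] ballI le)
  have "(step ^^ 0) W \<subseteq> ?X" by blast
  then show "W \<subseteq> ?X" by simp
  fix a assume a: "a \<in> C"
  show "\<theta> a `` ?X \<subseteq> ?X"
  proof
    fix y assume "y \<in> \<theta> a `` ?X"
    then obtain n where "y \<in> \<theta> a `` ((step ^^ n) W)" by blast
    then have "y \<in> (step ^^ Suc n) W" using a by (auto simp: step_def)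
    then show "y \<in> ?X" by blast
  qed
qed

lemma representation_rebase:
  includes cardinal_syntax
  fixes \<theta> :: "'a \<Rightarrow> 'x pfun"
  assumes alg: "partial_algebra \<sigma> A" and rep: "representation \<sigma> A \<theta>"
  obtains \<phi> :: "'x \<times> 'x \<Rightarrow> ('a + nat) \<times> ('a + nat)" and D
  where "representation \<sigma> A (\<lambda>a. \<phi> ` (\<theta> a \<inter> D))"
proof -
  let ?C = "carrier A"
  let ?U = "UNIV :: ('a + nat) set"
  obtain F where F: "\<And>f. f \<in> F \<Longrightarrow> single_valued f"
    and iso: "isomorphism \<sigma> A (pfun_palg F) \<theta>"
    using rep unfolding representation_def partial_algebra_of_pfuns_def by blast
  have bij: "bij_betw \<theta> ?C F"
    using iso by (simp add: isomorphism_def pfun_palg_def)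
  have sv: "single_valued (\<theta> a)" if "a \<in> ?C" for a
    using F bij that by (auto simp: bij_betw_def)
  define w1 where "w1 a b = (SOME x. x \<in> Domain (\<theta> a) \<inter> Domain (\<theta> b))" for a b
  define w2 where "w2 a b = (SOME x. x \<in> Domain (\<theta> a - \<theta> b))" for a b
  define W where "W = (\<Union>a\<in>?C. \<Union>b\<in>?C. {w1 a b, w2 a b})"
  have C: "|?C| \<le>o |?U|"
    by (rule card_of_ordLeqI[where f = Inl]) auto
  have two: "|{w1 a b, w2 a b}| \<le>o |?U|" for a b
  proof -
    have "|{w1 a b, w2 a b}| <o natLeq"
      by (simp flip: finite_iff_ordLess_natLeq)
    moreover have "natLeq \<le>o |?U|"
      using infinite_sum_nat infinite_iff_natLeq_ordLeq by blast
    ultimately show ?thesis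
      using ordLess_imp_ordLeq ordLeq_transitive by blast
  qed
  have W: "|W| \<le>o |?U|"
    unfolding W_def
    by (intro card_of_UNION_ordLeq_infinite[OF infinite_sum_nat C] ballI two)
  obtain X where X: "W \<subseteq> X" "\<And>a. a \<in> ?C \<Longrightarrow> \<theta> a `` X \<subseteq> X" "|X| \<le>o |?U|"
    using small_closed_superset[where C = ?C and \<theta> = \<theta>, OF sv W] by metis
  obtain g :: "'x \<Rightarrow> 'a + nat" where g: "inj_on g X"
    using X(3) card_of_ordLeq[of X ?U] by auto
  define \<phi> where "\<phi> = map_prod g g"
  define \<theta>' where "\<theta>' a = \<phi> ` (\<theta> a \<inter> X \<times> UNIV)" for a
  have im: "\<theta>' a = {(g x, g y) | x y. (x, y) \<in> \<theta> a \<and> x \<in> X}" for a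
    by (force simp: \<theta>'_def \<phi>_def)
  have mem: "(g x, g y) \<in> \<theta>' a \<longleftrightarrow> (x, y) \<in> \<theta> a" if "a \<in> ?C" "x \<in> X" "y \<in> X" for x y a
  proof
    assume "(g x, g y) \<in> \<theta>' a"
    then obtain x' y' where *: "g x = g x'" "g y = g y'" "(x', y') \<in> \<theta> a" "x' \<in> X"
      by (auto simp: im)
    then have "y' \<in> X" using X(2)[OF that(1)] by blast
    with * that g show "(x, y) \<in> \<theta> a" by (metis inj_onD)
  qed (use that in \<open>auto simp: im\<close>)
  have elem: "\<exists>x y. p = (g x, g y) \<and> x \<in> X \<and> y \<in> X \<and> (x, y) \<in> \<theta> a"
    if "a \<in> ?C" "p \<in> \<theta>' a" for p a
    using that X(2)[OF that(1)] by (auto simp: im)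
  have sub: "\<theta>' a \<subseteq> \<theta>' b \<longleftrightarrow> \<theta> a \<subseteq> \<theta> b" if ab: "a \<in> ?C" "b \<in> ?C" for a b
  proof
    assume s: "\<theta>' a \<subseteq> \<theta>' b"
    show "\<theta> a \<subseteq> \<theta> b"
    proof (rule ccontr)
      assume "\<not> \<theta> a \<subseteq> \<theta> b"
      then have "\<exists>x. x \<in> Domain (\<theta> a - \<theta> b)" by auto
      then have "w2 a b \<in> Domain (\<theta> a - \<theta> b)" unfolding w2_def by (rule someI_ex)
      then obtain y where y: "(w2 a b, y) \<in> \<theta> a" "(w2 a b, y) \<notin> \<theta> b" by blast
      have w: "w2 a b \<in> X" using X(1) ab by (auto simp: W_def)
      then have "y \<in> X" using y(1) X(2)[OF ab(1)] by blast
      then show False using s y w mem ab by blast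
    qed
  qed (unfold im, blast)
  have dom: "Domain (\<theta>' a) \<inter> Domain (\<theta>' b) = {} \<longleftrightarrow> Domain (\<theta> a) \<inter> Domain (\<theta> b) = {}"
    if ab: "a \<in> ?C" "b \<in> ?C" for a b
  proof
    assume s: "Domain (\<theta>' a) \<inter> Domain (\<theta>' b) = {}"
    show "Domain (\<theta> a) \<inter> Domain (\<theta> b) = {}"
    proof (rule ccontr)
      assume "Domain (\<theta> a) \<inter> Domain (\<theta> b) \<noteq> {}"
      then have "\<exists>x. x \<in> Domain (\<theta> a) \<inter> Domain (\<theta> b)" by auto
      then have w1: "w1 a b \<in> Domain (\<theta> a) \<inter> Domain (\<theta> b)" unfolding w1_def by (rule someI_ex)
      have "w1 a b \<in> X" using X(1) ab by (auto simp: W_def)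
      then have "g (w1 a b) \<in> Domain (\<theta>' a) \<inter> Domain (\<theta>' b)"
        using w1 unfolding im by blast
      then show False using s by blast
    qed
  next
    assume s: "Domain (\<theta> a) \<inter> Domain (\<theta> b) = {}"
    show "Domain (\<theta>' a) \<inter> Domain (\<theta>' b) = {}"
    proof (rule ccontr)
      assume "Domain (\<theta>' a) \<inter> Domain (\<theta>' b) \<noteq> {}"
      then obtain x y where xy: "x \<in> X" "y \<in> X" "g x = g y"
          "x \<in> Domain (\<theta> a)" "y \<in> Domain (\<theta> b)"
        unfolding im by auto
      then have "x = y" using g by (auto dest: inj_onD)
      then show False using s xy by blast
    qed
  qed
  have inj: "inj_on \<theta>' ?C"
  proof (rule inj_onI)
    fix a b assume "a \<in> ?C" "b \<in> ?C" "\<theta>' a = \<theta>' b"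
    then have "\<theta> a = \<theta> b" using sub by blast
    then show "a = b" using bij \<open>a \<in> ?C\<close> \<open>b \<in> ?C\<close> by (auto simp: bij_betw_def dest: inj_onD)
  qed
  have join: "map_option \<theta>' (djoin A a b) = dd_union (\<theta>' a) (\<theta>' b)"
    if "DJoin \<in> \<sigma>" and ab: "a \<in> ?C" "b \<in> ?C" for a b
  proof -
    have *: "map_option \<theta> (djoin A a b) = dd_union (\<theta> a) (\<theta> b)"
      using iso that by (simp add: isomorphism_def pfun_palg_def)
    show ?thesis
    proof (cases "djoin A a b")
      case None
      then show ?thesis using * dom[OF ab] by (auto simp: dd_union_def split: if_splits)
    next
      case (Some c)
      then have "\<theta> c = \<theta> a \<union> \<theta> b" "Domain (\<theta> a) \<inter> Domain (\<theta> b) = {}"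
        using * by (auto simp: dd_union_def split: if_splits)
      then show ?thesis using Some dom[OF ab]
        by (simp add: dd_union_def) (auto simp: im)
    qed
  qed
  have minus: "map_option \<theta>' (dminus A a b) = subset_compl (\<theta>' a) (\<theta>' b)"
    if "DMinus \<in> \<sigma>" and ab: "a \<in> ?C" "b \<in> ?C" for a b
  proof -
    have *: "map_option \<theta> (dminus A a b) = subset_compl (\<theta> a) (\<theta> b)"
      using iso that by (simp add: isomorphism_def pfun_palg_def)
    show ?thesis
    proof (cases "dminus A a b")
      case None
      then show ?thesis using * sub[OF ab(2,1)] by (auto simp: subset_compl_def split: if_splits)
    next
      case (Some c)
      then have c: "\<theta> c = \<theta> a - \<theta> b" "\<theta> b \<subseteq> \<theta> a"
        using * by (auto simp: subset_compl_def split: if_splits)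
      have "c \<in> ?C" using alg Some that unfolding partial_algebra_def by blast
      have "\<theta>' c = \<theta>' a - \<theta>' b"
      proof (intro equalityI subsetI)
        fix p assume "p \<in> \<theta>' c"
        then obtain x y where p: "p = (g x, g y)" "x \<in> X" "y \<in> X" "(x, y) \<in> \<theta> c"
          using elem[OF \<open>c \<in> ?C\<close>] by blast
        then show "p \<in> \<theta>' a - \<theta>' b" using c(1) mem ab by simp
      next
        fix p assume "p \<in> \<theta>' a - \<theta>' b"
        moreover from this obtain x y where p: "p = (g x, g y)" "x \<in> X" "y \<in> X" "(x, y) \<in> \<theta> a"
          using elem[OF ab(1)] by blast
        ultimately show "p \<in> \<theta>' c" using c(1) mem ab \<open>c \<in> ?C\<close> by simp
      qed
      then show ?thesis using Some c(2) sub[OF ab(2,1)] by (simp add: subset_compl_def)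
    qed
  qed
  have comp: "\<theta>' (comp A a b) = \<theta>' a O \<theta>' b"
    if "Comp \<in> \<sigma>" and ab: "a \<in> ?C" "b \<in> ?C" for a b
  proof -
    have c: "\<theta> (comp A a b) = \<theta> a O \<theta> b"
      using iso that by (simp add: isomorphism_def pfun_palg_def)
    have cC: "comp A a b \<in> ?C" using alg that unfolding partial_algebra_def by blast
    show ?thesis
    proof (intro equalityI subsetI)
      fix p assume "p \<in> \<theta>' (comp A a b)"
      then obtain x z where p: "p = (g x, g z)" "x \<in> X" "(x, z) \<in> \<theta> a O \<theta> b"
        using elem[OF cC] c by blast
      then obtain y where y: "(x, y) \<in> \<theta> a" "(y, z) \<in> \<theta> b" by blast
      then have "y \<in> X" using X(2)[OF ab(1)] p by blast
      then have "(g x, g y) \<in> \<theta>' a" "(g y, g z) \<in> \<theta>' b" using y p unfolding im by blast+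
      then show "p \<in> \<theta>' a O \<theta>' b" using p by blast
    next
      fix p assume "p \<in> \<theta>' a O \<theta>' b"
      then obtain u v w where uvw: "p = (u, w)" "(u, v) \<in> \<theta>' a" "(v, w) \<in> \<theta>' b" by blast
      obtain x y where xy: "u = g x" "v = g y" "x \<in> X" "y \<in> X" "(x, y) \<in> \<theta> a"
        using elem[OF ab(1) uvw(2)] by blast
      obtain y' z where yz: "v = g y'" "w = g z" "y' \<in> X" "z \<in> X" "(y', z) \<in> \<theta> b"
        using elem[OF ab(2) uvw(3)] by blast
      have "y = y'" using g xy yz by (metis inj_onD)
      then have "(x, z) \<in> \<theta> (comp A a b)" using c xy yz by blast
      then show "p \<in> \<theta>' (comp A a b)" using uvw xy yz unfolding im by blast
    qed
  qed
  have zero: "\<theta>' (zero A) = {}" if "Zero \<in> \<sigma>"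
    using iso that by (simp add: isomorphism_def pfun_palg_def \<theta>'_def)
  have iso': "isomorphism \<sigma> A (pfun_palg (\<theta>' ` ?C)) \<theta>'"
    unfolding isomorphism_def pfun_palg_def
    using inj join minus comp zero by (simp add: bij_betw_def)
  have "partial_algebra \<sigma> (pfun_palg (\<theta>' ` ?C))"
  proof -
    have 1: "h \<in> \<theta>' ` ?C"
      if h: "DJoin \<in> \<sigma>" "a \<in> ?C" "b \<in> ?C" "dd_union (\<theta>' a) (\<theta>' b) = Some h" for a b h
    proof -
      obtain c where c: "djoin A a b = Some c" "h = \<theta>' c"
        using join[OF h(1-3)] h(4) by (cases "djoin A a b") auto
      have "c \<in> ?C" using alg c(1) h(1-3) unfolding partial_algebra_def by blast
      then show ?thesis using c(2) by blast
    qed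
    have 2: "h \<in> \<theta>' ` ?C"
      if h: "DMinus \<in> \<sigma>" "a \<in> ?C" "b \<in> ?C" "subset_compl (\<theta>' a) (\<theta>' b) = Some h" for a b h
    proof -
      obtain c where c: "dminus A a b = Some c" "h = \<theta>' c"
        using minus[OF h(1-3)] h(4) by (cases "dminus A a b") auto
      have "c \<in> ?C" using alg c(1) h(1-3) unfolding partial_algebra_def by blast
      then show ?thesis using c(2) by blast
    qed
    have 3: "\<theta>' a O \<theta>' b \<in> \<theta>' ` ?C" if "Comp \<in> \<sigma>" "a \<in> ?C" "b \<in> ?C" for a b
    proof -
      have "comp A a b \<in> ?C" using alg that unfolding partial_algebra_def by blast
      then show ?thesis using comp[OF that] by (metis imageI)
    qed
    have 4: "{} \<in> \<theta>' ` ?C" if "Zero \<in> \<sigma>"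
    proof -
      have "zero A \<in> ?C" using alg that unfolding partial_algebra_def by blast
      then show ?thesis using zero[OF that] by (metis imageI)
    qed
    show ?thesis
      unfolding partial_algebra_def pfun_palg_def using 1 2 3 4 by auto
  qed
  moreover have "single_valued (\<theta>' a)" if a: "a \<in> ?C" for a
  proof (rule single_valuedI)
    fix u v v' assume uv: "(u, v) \<in> \<theta>' a" "(u, v') \<in> \<theta>' a"
    obtain x y where xy: "u = g x" "v = g y" "x \<in> X" "(x, y) \<in> \<theta> a"
      using elem[OF a uv(1)] by blast
    obtain x' y' where xy': "u = g x'" "v' = g y'" "x' \<in> X" "(x', y') \<in> \<theta> a"
      using elem[OF a uv(2)] by blast
    have "x = x'" using g xy xy' by (metis inj_onD)
    then show "v = v'" using sv[OF a] xy xy' by (metis single_valuedD)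
  qed
  ultimately have "representation \<sigma> A \<theta>'"
    unfolding representation_def partial_algebra_of_pfuns_def using iso' by blast
  moreover have "\<theta>' = (\<lambda>a. \<phi> ` (\<theta> a \<inter> X \<times> UNIV))" by (rule ext) (rule \<theta>'_def)
  ultimately show ?thesis using that by metis
qed

lemma representableI:
  fixes \<theta> :: "'a \<Rightarrow> 'x pfun"
  assumes "partial_algebra \<sigma> A" and "representation \<sigma> A \<theta>"
  shows "representable \<sigma> A"
  using representation_rebase[OF assms] unfolding representable_def by metis

lemma completely_representableI:
  fixes \<theta> :: "'a \<Rightarrow> 'x pfun"
  assumes alg: "partial_algebra \<sigma> A" and rep: "complete_representation \<sigma> A \<theta>"
  shows "completely_representable \<sigma> A"
proof -
  obtain \<phi> :: "'x \<times> 'x \<Rightarrow> ('a + nat) \<times> ('a + nat)" and D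
    where *: "representation \<sigma> A (\<lambda>a. \<phi> ` (\<theta> a \<inter> D))"
    using representation_rebase[OF alg] rep unfolding complete_representation_def by metis
  have "complete_representation \<sigma> A (\<lambda>a. \<phi> ` (\<theta> a \<inter> D))"
    unfolding complete_representation_def
  proof (intro conjI allI impI *)
    fix S a
    assume "S \<subseteq> carrier A" "pairwise_combinable A S" "is_supremum A S a"
    then have "\<theta> a = (\<Union>s\<in>S. \<theta> s)" using rep unfolding complete_representation_def by blast
    then show "\<phi> ` (\<theta> a \<inter> D) = (\<Union>s\<in>S. \<phi> ` (\<theta> s \<inter> D))" by auto
  qed
  then show ?thesis unfolding completely_representable_def by blast
qed

end

theory Submission
  imports Defs "HOL-Combinatorics.Transposition"
begin

text \<open>
  Call two cells of an \<open>M \<times> N\<close> grid orthogonal if they are distinct and share a row or a column.  The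
  grid algebra consists of the orthogonally closed sets generated by the finite parts of rows and
  columns, with relative orthocomplement as subtraction and trivial composition.  Every row and
  every column of atoms is a partition of the top element.  So if these partitions are preserved,
  any point in the image of the top lies in exactly one atom of each row and of each column, and
  thus picks out a bijection from \<open>M\<close> to \<open>N\<close>; conversely, if there is a bijection then the set of all
  of them is a base for a complete representation.  The partitions are preserved by every
  representation if the grid is finite, and by every complete representation in any case.  On the
  other hand first-order sentences of bounded depth see the sizes of \<open>M\<close> and \<open>N\<close> only up to a finite
  threshold.  Hence the grids \<open>m \<times> m\<close> and \<open>m \<times> (m + 1)\<close> refute finite axiomatisability, and a
  countable square grid together with a grid with countably many rows and uncountably many columns
  refutes closure under elementary equivalence.
\<close>

section \<open>Back and forth\<close>

primrec qdepth :: "fm \<Rightarrow> nat" where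
  "qdepth (Eq s t) = 0"
| "qdepth (J s t u) = 0"
| "qdepth (K s t u) = 0"
| "qdepth (Neg p) = qdepth p"
| "qdepth (Conj p q) = max (qdepth p) (qdepth q)"
| "qdepth (Ex n p) = Suc (qdepth p)"

definition atomic :: "fm \<Rightarrow> bool" where
  "atomic p \<longleftrightarrow> (\<exists>s t u. p \<in> {Eq s t, J s t u, K s t u})"

text \<open>An Ehrenfeucht-Fraisse game in abstract form: \<open>Z k V e e'\<close> is a position
  with \<open>k\<close> rounds to go in which the variables of \<open>V\<close> have been assigned.
  Each quantifier costs one round. Tracking \<open>V\<close> leaves all other variables free, so the
  game for a sentence starts from arbitrary assignments with \<open>V = {}\<close>.\<close>

lemma back_and_forth:
  fixes A :: "'a palg" and B :: "'b palg"
    and Z :: "nat \<Rightarrow> nat set \<Rightarrow> (nat \<Rightarrow> 'a) \<Rightarrow> (nat \<Rightarrow> 'b) \<Rightarrow> bool"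
  assumes atomic: "\<And>k V e e' p. Z k V e e' \<Longrightarrow> atomic p \<Longrightarrow> fm_syms p \<subseteq> \<sigma> \<Longrightarrow> fm_fvs p \<subseteq> V \<Longrightarrow>
      sat A e p \<longleftrightarrow> sat B e' p"
    and forward: "\<And>k V e e' n a. Z (Suc k) V e e' \<Longrightarrow> a \<in> carrier A \<Longrightarrow>
      \<exists>b\<in>carrier B. Z k (insert n V) (e(n := a)) (e'(n := b))"
    and backward: "\<And>k V e e' n b. Z (Suc k) V e e' \<Longrightarrow> b \<in> carrier B \<Longrightarrow>
      \<exists>a\<in>carrier A. Z k (insert n V) (e(n := a)) (e'(n := b))"
  shows "Z k V e e' \<Longrightarrow> qdepth p \<le> k \<Longrightarrow> fm_syms p \<subseteq> \<sigma> \<Longrightarrow> fm_fvs p \<subseteq> V \<Longrightarrow>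
    sat A e p \<longleftrightarrow> sat B e' p"
proof (induction p arbitrary: k V e e')
  case (Ex n p)
  obtain k' where k: "k = Suc k'" "qdepth p \<le> k'"
    using Ex.prems(2) by (cases k) auto
  have sat: "sat A (e(n := a)) p \<longleftrightarrow> sat B (e'(n := b)) p"
    if "Z k' (insert n V) (e(n := a)) (e'(n := b))" for a b
    using Ex.prems(3,4) by (intro Ex.IH[OF that k(2)]) auto
  show ?case
    using forward[of k' V e e' _ n] backward[of k' V e e' _ n] Ex.prems(1) sat
    unfolding k(1) sat.simps by metis
next
  case (Neg p)
  have "sat A e p \<longleftrightarrow> sat B e' p" using Neg.prems by (intro Neg.IH[of k V]) auto
  then show ?case by simp
next
  case (Conj p q)
  have "sat A e p \<longleftrightarrow> sat B e' p" using Conj.prems by (intro Conj.IH(1)[of k V]) auto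
  moreover have "sat A e q \<longleftrightarrow> sat B e' q" using Conj.prems by (intro Conj.IH(2)[of k V]) auto
  ultimately show ?case by simp
qed (rule atomic; simp add: atomic_def)+

section \<open>Isomorphisms\<close>

lemma isomorphismD:
  assumes "isomorphism \<sigma> A B g"
  shows "bij_betw g (carrier A) (carrier B)"
    and "DJoin \<in> \<sigma> \<Longrightarrow> a \<in> carrier A \<Longrightarrow> b \<in> carrier A \<Longrightarrow> djoin B (g a) (g b) = map_option g (djoin A a b)"
    and "DMinus \<in> \<sigma> \<Longrightarrow> a \<in> carrier A \<Longrightarrow> b \<in> carrier A \<Longrightarrow> dminus B (g a) (g b) = map_option g (dminus A a b)"
    and "Comp \<in> \<sigma> \<Longrightarrow> a \<in> carrier A \<Longrightarrow> b \<in> carrier A \<Longrightarrow> comp B (g a) (g b) = g (comp A a b)"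
    and "Zero \<in> \<sigma> \<Longrightarrow> zero B = g (zero A)"
  using assms unfolding isomorphism_def by auto

lemma isomorphism_mem:
  assumes "isomorphism \<sigma> A B g" "a \<in> carrier A"
  shows "g a \<in> carrier B"
  using isomorphismD(1)[OF assms(1)] assms(2) by (auto simp: bij_betw_def)

lemma isomorphism_eq_iff:
  assumes "isomorphism \<sigma> A B g" "a \<in> carrier A" "b \<in> carrier A"
  shows "g a = g b \<longleftrightarrow> a = b"
  using isomorphismD(1)[OF assms(1)] assms(2,3) by (auto simp: bij_betw_def dest: inj_onD)

lemma partial_algebraD:
  assumes "partial_algebra \<sigma> A"
  shows "DJoin \<in> \<sigma> \<Longrightarrow> a \<in> carrier A \<Longrightarrow> b \<in> carrier A \<Longrightarrow> djoin A a b = Some c \<Longrightarrow> c \<in> carrier A"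
    and "DMinus \<in> \<sigma> \<Longrightarrow> a \<in> carrier A \<Longrightarrow> b \<in> carrier A \<Longrightarrow> dminus A a b = Some c \<Longrightarrow> c \<in> carrier A"
    and "Comp \<in> \<sigma> \<Longrightarrow> a \<in> carrier A \<Longrightarrow> b \<in> carrier A \<Longrightarrow> comp A a b \<in> carrier A"
    and "Zero \<in> \<sigma> \<Longrightarrow> zero A \<in> carrier A"
  using assms unfolding partial_algebra_def by blast+

lemma isomorphism_compose:
  assumes f: "isomorphism \<sigma> A B f" and g: "isomorphism \<sigma> B C g"
  shows "isomorphism \<sigma> A C (\<lambda>a. g (f a))"
  unfolding isomorphism_def
proof (intro conjI impI ballI)
  show "bij_betw (\<lambda>a. g (f a)) (carrier A) (carrier C)"
    using bij_betw_trans[OF isomorphismD(1)[OF f] isomorphismD(1)[OF g]] by (simp add: o_def)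
qed (simp_all add: isomorphismD[OF f] isomorphismD[OF g] isomorphism_mem[OF f] option.map_comp o_def)

text \<open>The inverse undoes \<open>g\<close> on the carrier only, so closure of \<open>A\<close>
  is needed to keep the values of the operations there.\<close>

lemma isomorphism_inv:
  assumes alg: "partial_algebra \<sigma> A" and g: "isomorphism \<sigma> A B g"
  shows "isomorphism \<sigma> B A (inv_into (carrier A) g)"
proof -
  let ?h = "inv_into (carrier A) g"
  have bij: "bij_betw ?h (carrier B) (carrier A)"
    by (rule bij_betw_inv_into[OF isomorphismD(1)[OF g]])
  have hg: "?h (g a) = a" if "a \<in> carrier A" for a
    using bij_betw_inv_into_left[OF isomorphismD(1)[OF g] that] .
  have surj: "\<exists>a\<in>carrier A. x = g a" if "x \<in> carrier B" for x
    using isomorphismD(1)[OF g] that by (auto simp: bij_betw_def)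
  have opt: "map_option ?h (map_option g z) = z" if "\<And>c. z = Some c \<Longrightarrow> c \<in> carrier A" for z
    using that hg by (cases z) auto
  show ?thesis
    unfolding isomorphism_def
  proof (intro conjI impI ballI bij)
    fix x y assume s: "DJoin \<in> \<sigma>" and "x \<in> carrier B" "y \<in> carrier B"
    then obtain a b where ab: "a \<in> carrier A" "b \<in> carrier A" "x = g a" "y = g b" using surj by metis
    show "map_option ?h (djoin B x y) = djoin A (?h x) (?h y)"
      unfolding ab(3,4) isomorphismD(2)[OF g s ab(1,2)] hg[OF ab(1)] hg[OF ab(2)]
      by (rule opt[OF partial_algebraD(1)[OF alg s ab(1,2)]])
  next
    fix x y assume s: "DMinus \<in> \<sigma>" and "x \<in> carrier B" "y \<in> carrier B"
    then obtain a b where ab: "a \<in> carrier A" "b \<in> carrier A" "x = g a" "y = g b" using surj by metis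
    show "map_option ?h (dminus B x y) = dminus A (?h x) (?h y)"
      unfolding ab(3,4) isomorphismD(3)[OF g s ab(1,2)] hg[OF ab(1)] hg[OF ab(2)]
      by (rule opt[OF partial_algebraD(2)[OF alg s ab(1,2)]])
  next
    fix x y assume s: "Comp \<in> \<sigma>" and "x \<in> carrier B" "y \<in> carrier B"
    then obtain a b where "a \<in> carrier A" "b \<in> carrier A" "x = g a" "y = g b" using surj by metis
    then show "?h (comp B x y) = comp A (?h x) (?h y)"
      using s partial_algebraD(3)[OF alg] by (simp add: isomorphismD(4)[OF g] hg)
  next
    assume "Zero \<in> \<sigma>"
    then show "?h (zero B) = zero A"
      using partial_algebraD(4)[OF alg] by (simp add: isomorphismD(5)[OF g] hg)
  qed
qed

text \<open>The game in which every move is answered through \<open>g\<close> or its inverse. It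
  never runs out of rounds, so the invariant ignores \<open>k\<close>; for \<open>V = {}\<close> it
  is vacuous.\<close>

lemma isomorphism_sat:
  assumes alg: "partial_algebra \<sigma> A" and g: "isomorphism \<sigma> A B g"
    and "sentence \<sigma> p"
  shows "sat A e p \<longleftrightarrow> sat B e' p"
proof (rule back_and_forth[where Z = "\<lambda>k V e e'. \<forall>n\<in>V. e n \<in> carrier A \<and> e' n = g (e n)"
      and V = "{}" and \<sigma> = \<sigma>, OF _ _ _ _ order_refl])
  fix V e e' p
  assume Z: "\<forall>n\<in>V. e n \<in> carrier A \<and> e' n = g (e n)" and p: "atomic p" "fm_syms p \<subseteq> \<sigma>" "fm_fvs p \<subseteq> V"
  have tm: "tm_val A e t \<in> carrier A \<and> tm_val B e' t = g (tm_val A e t)"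
    if "tm_syms t \<subseteq> \<sigma>" "tm_fvs t \<subseteq> V" for t
    using that
  proof (induction t)
    case (CompT s t)
    then show ?case using partial_algebraD(3)[OF alg] isomorphismD(4)[OF g] by auto
  qed (use Z partial_algebraD(4)[OF alg] isomorphismD(5)[OF g] in auto)
  \<comment> \<open>\<open>g\<close> is injective on the carrier only, so the values of partial
    operations must be known to lie in it.\<close>
  have opt: "map_option g z = Some (g c) \<longleftrightarrow> z = Some c"
    if "c \<in> carrier A" "\<And>c. z = Some c \<Longrightarrow> c \<in> carrier A" for z c
    using that isomorphism_eq_iff[OF g] by (cases z) auto
  obtain s t u where stu: "p \<in> {Eq s t, J s t u, K s t u}" using p(1) by (auto simp: atomic_def)
  let ?s = "tm_val A e s" and ?t = "tm_val A e t" and ?u = "tm_val A e u"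
  have st: "tm_val A e s \<in> carrier A" "tm_val B e' s = g (tm_val A e s)"
    "tm_val A e t \<in> carrier A" "tm_val B e' t = g (tm_val A e t)"
    using stu p(2,3) tm by auto
  have u: "tm_val A e u \<in> carrier A" "tm_val B e' u = g (tm_val A e u)" if "p \<noteq> Eq s t"
    using that stu p(2,3) tm by auto
  from stu consider "p = Eq s t" | "p = J s t u" | "p = K s t u" by blast
  then show "sat A e p \<longleftrightarrow> sat B e' p"
  proof cases
    case 1
    then show ?thesis using st isomorphism_eq_iff[OF g] by simp
  next
    case 2
    then have "DJoin \<in> \<sigma>" using p(2) by simp
    then have "map_option g (djoin A ?s ?t) = djoin B (g ?s) (g ?t)" "\<And>c. djoin A ?s ?t = Some c \<Longrightarrow> c \<in> carrier A"
      using st partial_algebraD(1)[OF alg] isomorphismD(2)[OF g] by metis+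
    moreover have "?u \<in> carrier A" "tm_val B e' u = g ?u" using u 2 by simp_all
    ultimately show ?thesis
      unfolding 2 sat.simps st(2,4) by (metis opt)
  next
    case 3
    then have "DMinus \<in> \<sigma>" using p(2) by simp
    then have "map_option g (dminus A ?s ?t) = dminus B (g ?s) (g ?t)" "\<And>c. dminus A ?s ?t = Some c \<Longrightarrow> c \<in> carrier A"
      using st partial_algebraD(2)[OF alg] isomorphismD(3)[OF g] by metis+
    moreover have "?u \<in> carrier A" "tm_val B e' u = g ?u" using u 3 by simp_all
    ultimately show ?thesis
      unfolding 3 sat.simps st(2,4) by (metis opt)
  qed
next
  fix V e e' n b
  assume *: "\<forall>n\<in>V. e n \<in> carrier A \<and> e' n = g (e n)" "b \<in> carrier B"
  then obtain a where "a \<in> carrier A" "b = g a"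
    using isomorphismD(1)[OF g] by (auto simp: bij_betw_def)
  with * show "\<exists>a\<in>carrier A. \<forall>m\<in>insert n V. (e(n := a)) m \<in> carrier A \<and> (e'(n := b)) m = g ((e(n := a)) m)"
    by auto
qed (use assms(3) isomorphism_mem[OF g] in \<open>auto simp: sentence_def\<close>)

lemma isomorphism_models:
  assumes "partial_algebra \<sigma> A" "isomorphism \<sigma> A B g" "sentence \<sigma> p"
  shows "A \<Turnstile> p \<longleftrightarrow> B \<Turnstile> p"
  using isomorphism_sat[OF assms] unfolding models_def by blast

section \<open>Pulling representations back along isomorphisms\<close>

lemma representation_compose:
  assumes "isomorphism \<sigma> A B g" "representation \<sigma> B \<theta>"
  shows "representation \<sigma> A (\<lambda>a. \<theta> (g a))"
  using assms isomorphism_compose unfolding representation_def by blast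

text \<open>The order, combinability and suprema are all expressed by subtraction on the carrier, so
  \<open>g\<close> carries a combinable set with a supremum to another one.\<close>

lemma complete_representation_compose:
  assumes g: "isomorphism \<sigma> A B g" and \<theta>: "complete_representation \<sigma> B \<theta>" and s: "DMinus \<in> \<sigma>"
  shows "complete_representation \<sigma> A (\<lambda>a. \<theta> (g a))"
  unfolding complete_representation_def
proof (intro conjI allI impI)
  show "representation \<sigma> A (\<lambda>a. \<theta> (g a))"
    using \<theta> by (intro representation_compose[OF g]) (simp add: complete_representation_def)
next
  fix S a assume S: "S \<subseteq> carrier A" "pairwise_combinable A S" "is_supremum A S a"
  have le: "lesssim B (g x) (g y) \<longleftrightarrow> lesssim A x y" if "x \<in> carrier A" "y \<in> carrier A" for x y
    using that s by (simp add: lesssim_def isomorphismD(3)[OF g] isomorphism_eq_iff[OF g])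
  have im: "carrier B = g ` carrier A"
    using isomorphismD(1)[OF g] by (simp add: bij_betw_def)
  have "pairwise_combinable B (g ` S)"
    unfolding pairwise_combinable_def
  proof (intro ballI impI)
    fix x y assume "x \<in> g ` S" "y \<in> g ` S" "x \<noteq> y"
    then obtain s t where st: "x = g s" "y = g t" "s \<in> S" "t \<in> S" "s \<noteq> t" by blast
    then obtain u where "u \<in> carrier A" "dminus A u s = Some t"
      using S(2) unfolding pairwise_combinable_def by blast
    moreover from this have "dminus B (g u) (g s) = map_option g (dminus A u s)"
      using st S(1) s by (intro isomorphismD(3)[OF g]) auto
    ultimately show "\<exists>u\<in>carrier B. dminus B u x = Some y"
      unfolding st im by auto
  qed
  moreover have "is_supremum B (g ` S) (g a)"
    unfolding is_supremum_def im
  proof (intro conjI ballI impI; (elim imageE)?; (hypsubst)?)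
    have a: "a \<in> carrier A" using S(3) by (simp add: is_supremum_def)
    then show "g a \<in> g ` carrier A" by simp
    show "lesssim B (g s) (g a)" if "s \<in> S" for s
      using that a S(1,3) by (subst le) (auto simp: is_supremum_def)
    fix b assume b: "\<forall>x\<in>g ` S. lesssim B x (g b)" "b \<in> carrier A"
    have "\<forall>s\<in>S. lesssim A s b"
    proof
      fix s assume "s \<in> S"
      then show "lesssim A s b" using b le[of s b] S(1) by blast
    qed
    then have "lesssim A a b" using S(3) b(2) by (simp add: is_supremum_def)
    then show "lesssim B (g a) (g b)" using le[OF a b(2)] by simp
  qed
  moreover have "g ` S \<subseteq> carrier B" using S(1) im by blast
  ultimately have "\<theta> (g a) = (\<Union>s\<in>g ` S. \<theta> s)"
    using \<theta> unfolding complete_representation_def by blast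
  then show "\<theta> (g a) = (\<Union>s\<in>S. \<theta> (g s))" by simp
qed

text \<open>The classes in question contain algebras over one fixed type, whereas a grid algebra
  consists of sets of pairs; this copies it along an injection. Off the image of the carrier the
  operations are arbitrary.\<close>

definition transport :: "('a \<Rightarrow> 'b) \<Rightarrow> 'a palg \<Rightarrow> 'b palg" where
  "transport g A = (let h = inv_into (carrier A) g in
    \<lparr>carrier = g ` carrier A,
     djoin = \<lambda>x y. map_option g (djoin A (h x) (h y)),
     dminus = \<lambda>x y. map_option g (dminus A (h x) (h y)),
     comp = \<lambda>x y. g (comp A (h x) (h y)),
     zero = g (zero A)\<rparr>)"

lemma isomorphism_transport:
  assumes "inj_on g (carrier A)"
  shows "isomorphism \<sigma> A (transport g A) g"
  unfolding isomorphism_def transport_def Let_def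
  by (simp add: inv_into_f_f[OF assms] inj_on_imp_bij_betw[OF assms])

lemma partial_algebra_isomorphism:
  assumes alg: "partial_algebra \<sigma> A" and g: "isomorphism \<sigma> A B g"
  shows "partial_algebra \<sigma> B"
proof -
  have im: "carrier B = g ` carrier A"
    using isomorphismD(1)[OF g] by (simp add: bij_betw_def)
  show ?thesis
    unfolding partial_algebra_def im
  proof (intro conjI impI ballI allI; (elim imageE)?; hypsubst?)
    fix c a b
    assume "DJoin \<in> \<sigma>" "djoin B (g a) (g b) = Some c" "a \<in> carrier A" "b \<in> carrier A"
    then show "c \<in> g ` carrier A"
      using isomorphismD(2)[OF g, of a b] partial_algebraD(1)[OF alg, of a b] by auto
  next
    fix c a b
    assume "DMinus \<in> \<sigma>" "dminus B (g a) (g b) = Some c" "a \<in> carrier A" "b \<in> carrier A"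
    then show "c \<in> g ` carrier A"
      using isomorphismD(3)[OF g, of a b] partial_algebraD(2)[OF alg, of a b] by auto
  next
    fix a b
    assume "Comp \<in> \<sigma>" "a \<in> carrier A" "b \<in> carrier A"
    then show "comp B (g a) (g b) \<in> g ` carrier A"
      using isomorphismD(4)[OF g, of a b] partial_algebraD(3)[OF alg, of a b] by simp
  next
    assume "Zero \<in> \<sigma>"
    then show "zero B \<in> g ` carrier A"
      using isomorphismD(5)[OF g] partial_algebraD(4)[OF alg] by simp
  qed
qed

section \<open>The grid algebras\<close>

text \<open>That the two equations differ in truth value means that exactly one coordinate agrees,
  which is adjacency in the rook's graph.\<close>

definition perp :: "'m set \<Rightarrow> 'n set \<Rightarrow> ('m \<times> 'n) set \<Rightarrow> ('m \<times> 'n) set" where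
  "perp M N X = {(i, j). i \<in> M \<and> j \<in> N \<and> (\<forall>(i', j')\<in>X. (i = i') \<noteq> (j = j'))}"

text \<open>
  The generating sets are finite so that the algebra is no larger than the grid, which matters when
  the grid is uncountable.
\<close>

definition strips :: "'m set \<Rightarrow> 'n set \<Rightarrow> ('m \<times> 'n) set set" where
  "strips M N = {A \<times> B | A B. A \<subseteq> M \<and> B \<subseteq> N \<and> finite A \<and> finite B \<and> (card A = 1 \<or> card B = 1)}"

definition elements :: "'m set \<Rightarrow> 'n set \<Rightarrow> ('m \<times> 'n) set set" where
  "elements M N = perp M N ` strips M N \<union> (\<lambda>F. perp M N (perp M N F)) ` strips M N"

text \<open>The join is the De Morgan dual of the meet, restricted to orthogonal pairs. The constant
  composition is that of functions whose ranges avoid all domains.\<close>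

definition grid :: "'m set \<Rightarrow> 'n set \<Rightarrow> ('m \<times> 'n) set palg" where
  "grid M N = \<lparr>carrier = elements M N,
     djoin = \<lambda>a b. if a \<subseteq> perp M N b then Some (perp M N (perp M N a \<inter> perp M N b)) else None,
     dminus = \<lambda>a b. if b \<subseteq> a then Some (a \<inter> perp M N b) else None,
     comp = \<lambda>a b. {},
     zero = {}\<rparr>"

lemma grid_simps [simp]:
  "carrier (grid M N) = elements M N"
  "djoin (grid M N) a b = (if a \<subseteq> perp M N b then Some (perp M N (perp M N a \<inter> perp M N b)) else None)"
  "dminus (grid M N) a b = (if b \<subseteq> a then Some (a \<inter> perp M N b) else None)"
  "comp (grid M N) a b = {}"
  "zero (grid M N) = {}"
  by (simp_all add: grid_def)

definition lines :: "'m set \<Rightarrow> 'n set \<Rightarrow> ('m \<times> 'n) set set" where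
  "lines M N = (\<lambda>i. {i} \<times> N) ` M \<union> (\<lambda>j. M \<times> {j}) ` N"

text \<open>Along such a line the orthocomplement is the ordinary complement, so elements with a
  line in common can be compared and subtracted through their traces
  \<open>L \<inter> a\<close>.\<close>

definition fits :: "'m set \<Rightarrow> 'n set \<Rightarrow> ('m \<times> 'n) set \<Rightarrow> ('m \<times> 'n) set \<Rightarrow> bool" where
  "fits M N a L \<longleftrightarrow> L \<in> lines M N \<and> L \<subseteq> a \<union> perp M N a"

section \<open>Orthocomplement and closure\<close>

lemma perp_subset: "perp M N X \<subseteq> M \<times> N"
  by (auto simp: perp_def)

lemma perp_antimono: "X \<subseteq> Y \<Longrightarrow> perp M N Y \<subseteq> perp M N X"
  by (auto simp: perp_def)

text \<open>Orthogonality of cells is symmetric, which makes \<open>perp\<close> an antitone Galois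
  connection with itself; the closure laws are consequences.\<close>

lemma subset_perp_commute: "X \<subseteq> M \<times> N \<Longrightarrow> Y \<subseteq> M \<times> N \<Longrightarrow> X \<subseteq> perp M N Y \<longleftrightarrow> Y \<subseteq> perp M N X"
  unfolding perp_def by (auto; blast)

lemma perp_perp_subset: "X \<subseteq> M \<times> N \<Longrightarrow> X \<subseteq> perp M N (perp M N X)"
  using subset_perp_commute[OF _ perp_subset] by blast

lemma perp_perp_perp: "X \<subseteq> M \<times> N \<Longrightarrow> perp M N (perp M N (perp M N X)) = perp M N X"
  by (intro subset_antisym perp_antimono perp_perp_subset perp_subset)

lemma perp_disjoint: "X \<inter> perp M N X = {}"
  by (auto simp: perp_def)

lemma perp_empty: "perp M N {} = M \<times> N"
  by (auto simp: perp_def)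

lemma strips_subset: "F \<in> strips M N \<Longrightarrow> F \<subseteq> M \<times> N"
  by (auto simp: strips_def)

lemma elements_subset: "a \<in> elements M N \<Longrightarrow> a \<subseteq> M \<times> N"
  unfolding elements_def using perp_subset by blast

lemma elements_closed: "a \<in> elements M N \<Longrightarrow> perp M N (perp M N a) = a"
  unfolding elements_def using perp_perp_perp[OF strips_subset] by auto

lemma perp_elements: "a \<in> elements M N \<Longrightarrow> perp M N a \<in> elements M N"
  unfolding elements_def using perp_perp_perp[OF strips_subset] by fastforce

lemma lines_subset: "L \<in> lines M N \<Longrightarrow> L \<subseteq> M \<times> N"
  by (auto simp: lines_def)

section \<open>Lines carrying an element\<close>

lemma strip_subset_line:
  assumes "F \<in> strips M N"
  obtains L where "L \<in> lines M N" "F \<subseteq> L"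
proof -
  obtain A B where F: "F = A \<times> B" "A \<subseteq> M" "B \<subseteq> N" "card A = 1 \<or> card B = 1"
    using assms by (auto simp: strips_def)
  from F(4) show ?thesis
  proof
    assume "card A = 1"
    then obtain i where "A = {i}" by (auto simp: card_1_singleton_iff)
    then show ?thesis using F that[of "{i} \<times> N"] by (auto simp: lines_def)
  next
    assume "card B = 1"
    then obtain j where "B = {j}" by (auto simp: card_1_singleton_iff)
    then show ?thesis using F that[of "M \<times> {j}"] by (auto simp: lines_def)
  qed
qed

lemma strips_line:
  assumes "L \<in> lines M N" "F \<subseteq> L" "finite F"
  shows "F \<in> strips M N"
proof -
  from assms(1) consider i where "i \<in> M" "L = {i} \<times> N" | j where "j \<in> N" "L = M \<times> {j}"
    by (auto simp: lines_def)
  then show ?thesis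
  proof cases
    case 1
    then have "F = {i} \<times> snd ` F" using assms(2) by force
    moreover have "snd ` F \<subseteq> N" using 1 assms(2) by auto
    ultimately show ?thesis using 1 assms(3) unfolding strips_def
      by (intro CollectI exI[of _ "{i}"] exI[of _ "snd ` F"]) auto
  next
    case 2
    then have "F = fst ` F \<times> {j}" using assms(2) by force
    moreover have "fst ` F \<subseteq> M" using 2 assms(2) by auto
    ultimately show ?thesis using 2 assms(3) unfolding strips_def
      by (intro CollectI exI[of _ "fst ` F"] exI[of _ "{j}"]) auto
  qed
qed

lemma fits_perp: "perp M N (perp M N a) = a \<Longrightarrow> fits M N (perp M N a) L \<longleftrightarrow> fits M N a L"
  unfolding fits_def by auto

lemma line_minus_subset_perp:
  assumes "L \<in> lines M N" "S \<subseteq> L"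
  shows "L - S \<subseteq> perp M N S"
  using assms by (auto simp: lines_def perp_def)

text \<open>Cells of the line in \<open>F\<close> lie in its closure, and the others are orthogonal
  to \<open>F\<close>, since distinct cells of a line are orthogonal.\<close>

lemma fits_perp_subset_line:
  assumes "L \<in> lines M N" "F \<subseteq> L"
  shows "fits M N (perp M N F) L"
  unfolding fits_def
  using assms line_minus_subset_perp[OF assms] perp_perp_subset[of F M N] lines_subset[OF assms(1)] by blast

lemma fits_perp_perp_subset_line:
  assumes "L \<in> lines M N" "F \<subseteq> L"
  shows "fits M N (perp M N (perp M N F)) L"
  using fits_perp_subset_line[OF assms] perp_perp_perp[of F M N] lines_subset assms
  by (metis fits_perp order_trans)

lemma elements_fits:
  assumes "a \<in> elements M N"
  shows "\<exists>L. fits M N a L"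
  using assms unfolding elements_def
  by (auto elim!: strip_subset_line intro: fits_perp_subset_line fits_perp_perp_subset_line)

text \<open>A cell off a line is orthogonal to at most one cell of it, so two distinct cells of
  \<open>S\<close> force anything orthogonal to \<open>S\<close> onto the line.\<close>

lemma perp_subset_line:
  assumes "L \<in> lines M N" "S \<subseteq> L" "p \<in> S" "q \<in> S" "p \<noteq> q"
  shows "perp M N S \<subseteq> L - S"
proof -
  from assms(1) consider i where "i \<in> M" "L = {i} \<times> N" | j where "j \<in> N" "L = M \<times> {j}"
    by (auto simp: lines_def)
  then show ?thesis
  proof cases
    case 1
    then obtain x y where p: "p = (i, x)" "q = (i, y)" "x \<noteq> y"
      using assms(2-5) by (cases p; cases q) auto
    show ?thesis
    proof (clarify, rule DiffI)
      fix u v assume uv: "(u, v) \<in> perp M N S"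
      have "(u = i) \<noteq> (v = x)" "(u = i) \<noteq> (v = y)" using uv assms(3,4) p by (auto simp: perp_def)
      then show "(u, v) \<in> L" using 1 uv p(3) by (auto simp: perp_def)
      show "(u, v) \<notin> S" using uv perp_disjoint by blast
    qed
  next
    case 2
    then obtain x y where p: "p = (x, j)" "q = (y, j)" "x \<noteq> y"
      using assms(2-5) by (cases p; cases q) auto
    show ?thesis
    proof (clarify, rule DiffI)
      fix u v assume uv: "(u, v) \<in> perp M N S"
      have "(u = x) \<noteq> (v = j)" "(u = y) \<noteq> (v = j)" using uv assms(3,4) p by (auto simp: perp_def)
      then show "(u, v) \<in> L" using 2 uv p(3) by (auto simp: perp_def)
      show "(u, v) \<notin> S" using uv perp_disjoint by blast
    qed
  qed
qed

lemma finite_perp_line: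
  assumes "L \<in> lines M N" "q \<notin> L" "q \<in> M \<times> N"
  shows "finite (L \<inter> perp M N {q})"
proof -
  obtain x y where q: "q = (x, y)" by fastforce
  from assms(1) consider i where "i \<in> M" "L = {i} \<times> N" | j where "j \<in> N" "L = M \<times> {j}"
    by (auto simp: lines_def)
  then show ?thesis
  proof cases
    case 1
    then have "L \<inter> perp M N {q} \<subseteq> {(i, y)}" using assms q by (auto simp: perp_def)
    then show ?thesis using finite_subset by blast
  next
    case 2
    then have "L \<inter> perp M N {q} \<subseteq> {(x, j)}" using assms q by (auto simp: perp_def)
    then show ?thesis using finite_subset by blast
  qed
qed

text \<open>Any line carrying \<open>a\<close> may be given, not just that of the generating strip
  \<open>F\<close>. If \<open>F\<close> lies on it, the cells of the line outside
  \<open>perp M N F\<close> are in the finite \<open>F\<close>; otherwise a cell of \<open>F\<close>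
  off the line leaves at most one cell of the line in \<open>perp M N F\<close>. For the closure of
  a strip the two sides are swapped.\<close>

lemma fits_finite_or_cofinite:
  assumes a: "a \<in> elements M N" and L: "fits M N a L"
  shows "finite (L \<inter> a) \<or> finite (L - a)"
proof -
  have *: "finite (L \<inter> perp M N F) \<or> finite (L - perp M N F)"
    if F: "F \<in> strips M N" and "L \<in> lines M N" for F
  proof (cases "F \<subseteq> L")
    case True
    have "L - perp M N F \<subseteq> F" using line_minus_subset_perp[OF that(2) True] by blast
    moreover have "finite F" using F by (auto simp: strips_def)
    ultimately show ?thesis using finite_subset by blast
  next
    case False
    then obtain q where q: "q \<in> F" "q \<notin> L" by blast
    then have "perp M N F \<subseteq> perp M N {q}" by (intro perp_antimono) auto
    moreover have "finite (L \<inter> perp M N {q})"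
      using finite_perp_line[OF that(2) q(2)] q(1) strips_subset[OF F] by blast
    ultimately show ?thesis by (meson Int_mono finite_subset order_refl)
  qed
  have L': "L \<in> lines M N" using L by (simp add: fits_def)
  from a consider F where "F \<in> strips M N" "a = perp M N F"
    | F where "F \<in> strips M N" "a = perp M N (perp M N F)"
    by (auto simp: elements_def)
  then show ?thesis
  proof cases
    case 2
    let ?b = "perp M N F"
    have eq: "perp M N a = ?b" using 2 perp_perp_perp[OF strips_subset] by blast
    have "L \<inter> a = L - ?b" "L - a = L \<inter> ?b"
      using L perp_disjoint[of a M N] unfolding fits_def eq by auto
    then show ?thesis using *[OF 2(1) L'] by auto
  qed (use * L' in auto)
qed

section \<open>Grids with at least three rows and columns\<close>

locale large_grid =
  fixes M :: "'m set" and N :: "'n set"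
  assumes large_M: "\<And>i i'. \<exists>k\<in>M. k \<noteq> i \<and> k \<noteq> i'"
    and large_N: "\<And>j j'. \<exists>k\<in>N. k \<noteq> j \<and> k \<noteq> j'"
begin

abbreviation orth ("_\<^sup>\<bottom>" [999] 999) where "X\<^sup>\<bottom> \<equiv> perp M N X"

lemma large_line:
  assumes "L \<in> lines M N"
  shows "\<exists>r\<in>L. r \<noteq> p \<and> r \<noteq> q"
proof -
  from assms consider i where "i \<in> M" "L = {i} \<times> N" | j where "j \<in> N" "L = M \<times> {j}"
    by (auto simp: lines_def)
  then show ?thesis
  proof cases
    case 1
    with large_N[of "snd p" "snd q"] show ?thesis by force
  next
    case 2
    with large_M[of "fst p" "fst q"] show ?thesis by force
  qed
qed

lemma perp_line:
  assumes "L \<in> lines M N"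
  shows "L\<^sup>\<bottom> = {}"
proof -
  obtain p where p: "p \<in> L" using large_line[OF assms] by blast
  obtain q where q: "q \<in> L" "q \<noteq> p" using large_line[OF assms] by blast
  show ?thesis using perp_subset_line[OF assms order_refl p q(1)] q(2) by blast
qed

text \<open>Of the at least three cells of \<open>L\<close>, two lie on the same side of
  \<open>a\<close>, and \<open>perp_subset_line\<close> confines the orthocomplement of that side to
  \<open>L\<close>. So a closed set is determined by its trace on any line carrying it.\<close>

lemma fits_eq_perp:
  assumes L: "fits M N a L" and a: "a\<^sup>\<bottom>\<^sup>\<bottom> = a"
  shows "a = (L - a)\<^sup>\<bottom>"
proof
  have LL: "L \<in> lines M N" using L by (simp add: fits_def)
  have sub: "L \<subseteq> M \<times> N" "a \<subseteq> M \<times> N" using lines_subset[OF LL] a perp_subset by blast+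
  have 1: "L - a \<subseteq> a\<^sup>\<bottom>" using L by (auto simp: fits_def)
  then have "a\<^sup>\<bottom>\<^sup>\<bottom> \<subseteq> (L - a)\<^sup>\<bottom>" by (rule perp_antimono)
  then show "a \<subseteq> (L - a)\<^sup>\<bottom>" using a by simp
  show "(L - a)\<^sup>\<bottom> \<subseteq> a"
  proof (cases "\<exists>p q. p \<in> L - a \<and> q \<in> L - a \<and> p \<noteq> q")
    case True
    then obtain p q where "p \<in> L - a" "q \<in> L - a" "p \<noteq> q" by blast
    then have "(L - a)\<^sup>\<bottom> \<subseteq> L - (L - a)" by (intro perp_subset_line[OF LL]) auto
    then show ?thesis by blast
  next
    case False
    \<comment> \<open>At most one cell of \<open>L\<close> is outside \<open>a\<close>, so two cells
      \<open>q\<close> and \<open>r\<close> are inside, and the orthocomplement of \<open>a\<close>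
      is confined to \<open>L - a\<close>.\<close>
    obtain p where "\<forall>r\<in>L - a. r = p" using False by blast
    then obtain q where q: "q \<in> L \<inter> a" using large_line[OF LL, of p p] by blast
    obtain r where r: "r \<in> L \<inter> a" "r \<noteq> q" using large_line[OF LL, of p q] \<open>\<forall>r\<in>L - a. r = p\<close> by blast
    have "a\<^sup>\<bottom> \<subseteq> (L \<inter> a)\<^sup>\<bottom>" by (rule perp_antimono) auto
    also have "\<dots> \<subseteq> L - (L \<inter> a)" using q r by (intro perp_subset_line[OF LL]) auto
    finally have "(L - a)\<^sup>\<bottom> \<subseteq> a\<^sup>\<bottom>\<^sup>\<bottom>" by (intro perp_antimono) auto
    then show ?thesis using a by simp
  qed
qed

lemma fits_eq_perp_perp:
  assumes L: "fits M N a L" and a: "a\<^sup>\<bottom>\<^sup>\<bottom> = a"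
  shows "a = (L \<inter> a)\<^sup>\<bottom>\<^sup>\<bottom>"
proof -
  have "fits M N (a\<^sup>\<bottom>) L" using L fits_perp[OF a] by simp
  then have "a\<^sup>\<bottom> = (L - a\<^sup>\<bottom>)\<^sup>\<bottom>" using a by (intro fits_eq_perp) auto
  moreover have "L - a\<^sup>\<bottom> = L \<inter> a" using L perp_disjoint[of a M N] by (auto simp: fits_def)
  ultimately show ?thesis using a by metis
qed

text \<open>A generating strip is recovered as \<open>L \<inter> a\<close> or \<open>L - a\<close>,
  whichever is finite. In this form, closure under subtraction becomes a matter of traces on one
  line.\<close>

lemma elements_iff:
  "a \<in> elements M N \<longleftrightarrow> a\<^sup>\<bottom>\<^sup>\<bottom> = a \<and> (\<exists>L. fits M N a L \<and> (finite (L \<inter> a) \<or> finite (L - a)))"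
proof
  assume a: "a \<in> elements M N"
  then obtain L where "fits M N a L" using elements_fits by blast
  then show "a\<^sup>\<bottom>\<^sup>\<bottom> = a \<and> (\<exists>L. fits M N a L \<and> (finite (L \<inter> a) \<or> finite (L - a)))"
    using elements_closed[OF a] fits_finite_or_cofinite[OF a] by blast
next
  assume "a\<^sup>\<bottom>\<^sup>\<bottom> = a \<and> (\<exists>L. fits M N a L \<and> (finite (L \<inter> a) \<or> finite (L - a)))"
  then obtain L where a: "a\<^sup>\<bottom>\<^sup>\<bottom> = a" and L: "fits M N a L" and f: "finite (L \<inter> a) \<or> finite (L - a)"
    by blast
  have LL: "L \<in> lines M N" using L by (simp add: fits_def)
  from f have "L \<inter> a \<in> strips M N \<or> L - a \<in> strips M N"
    using strips_line[OF LL, of "L \<inter> a"] strips_line[OF LL, of "L - a"] by auto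
  then have "(L \<inter> a)\<^sup>\<bottom>\<^sup>\<bottom> \<in> elements M N \<or> (L - a)\<^sup>\<bottom> \<in> elements M N"
    unfolding elements_def by blast
  then show "a \<in> elements M N"
    using fits_eq_perp_perp[OF L a] fits_eq_perp[OF L a] by auto
qed

lemma empty_elements: "{} \<in> elements M N"
  and top_elements: "M \<times> N \<in> elements M N"
proof -
  obtain i where "i \<in> M" using large_M by blast
  then have L: "{i} \<times> N \<in> lines M N" by (auto simp: lines_def)
  have "{} \<in> strips M N" by (rule strips_line[OF L]) auto
  then show top: "M \<times> N \<in> elements M N" unfolding elements_def using perp_empty by blast
  have "(M \<times> N)\<^sup>\<bottom> \<subseteq> ({i} \<times> N)\<^sup>\<bottom>" using lines_subset[OF L] by (rule perp_antimono)
  then have "(M \<times> N)\<^sup>\<bottom> = {}" using perp_line[OF L] by blast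
  then show "{} \<in> elements M N" using perp_elements[OF top] by simp
qed

lemma top_nonempty: "M \<times> N \<noteq> {}"
  using large_M large_N by blast

text \<open>An empty or full trace identifies \<open>a\<close> as the closure or the orthocomplement
  of \<open>{}\<close>, and every line carries these.\<close>

lemma fits_trivial:
  assumes "L \<in> lines M N" "fits M N a L'" "a\<^sup>\<bottom>\<^sup>\<bottom> = a" "L' \<inter> a = {} \<or> L' - a = {}"
  shows "fits M N a L"
proof -
  have "a = {}\<^sup>\<bottom>\<^sup>\<bottom> \<or> a = {}\<^sup>\<bottom>"
    using fits_eq_perp[OF assms(2,3)] fits_eq_perp_perp[OF assms(2,3)] assms(4) by metis
  then show ?thesis
    using fits_perp_perp_subset_line[OF assms(1), of "{}"] fits_perp_subset_line[OF assms(1), of "{}"] by auto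
qed

text \<open>A trace of one cell, or of all but one, identifies \<open>a\<close> as the closure or
  the orthocomplement of that cell, which every line through the cell carries.\<close>

lemma fits_atom:
  assumes "L \<in> lines M N" "fits M N a L'" "a\<^sup>\<bottom>\<^sup>\<bottom> = a" "L' \<inter> a = {p} \<or> L' - a = {p}" "p \<in> L"
  shows "fits M N a L"
proof -
  have "a = {p}\<^sup>\<bottom>\<^sup>\<bottom> \<or> a = {p}\<^sup>\<bottom>"
    using fits_eq_perp[OF assms(2,3)] fits_eq_perp_perp[OF assms(2,3)] assms(4) by metis
  moreover have "fits M N ({p}\<^sup>\<bottom>\<^sup>\<bottom>) L" "fits M N ({p}\<^sup>\<bottom>) L"
    using assms(5) by (intro fits_perp_perp_subset_line fits_perp_subset_line assms(1); simp)+
  ultimately show ?thesis by metis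
qed

text \<open>Cells of \<open>b\<close> on its line \<open>L'\<close> are orthogonal to the cells
  missing from \<open>a\<close> on its line \<open>L\<close>. This is so restrictive that one or
  both elements can be moved to another line by \<open>fits_trivial\<close> or
  \<open>fits_atom\<close>.\<close>

lemma common_line:
  assumes a: "a \<in> elements M N" and b: "b \<in> elements M N" and ba: "b \<subseteq> a"
  shows "\<exists>L. fits M N a L \<and> fits M N b L"
proof -
  obtain L L' where L: "fits M N a L" "fits M N b L'" using elements_fits a b by blast
  have lines: "L \<in> lines M N" "L' \<in> lines M N" using L by (auto simp: fits_def)
  note ca = elements_closed[OF a] and cb = elements_closed[OF b]
  show ?thesis
  proof (cases "L' \<inter> b = {} \<or> L - a = {}")
    case True
    then show ?thesis
      using fits_trivial[OF lines(1) L(2) cb] fits_trivial[OF lines(2) L(1) ca] L by blast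
  next
    case False
    have orth: "(fst p = fst q) \<noteq> (snd p = snd q)" if "p \<in> L' \<inter> b" "q \<in> L - a" for p q
    proof -
      have "q \<in> a\<^sup>\<bottom>" using that L by (auto simp: fits_def)
      then show ?thesis using that ba by (force simp: perp_def)
    qed
    have atom: ?thesis if "L'' \<in> lines M N" "L' \<inter> b = {p} \<and> p \<in> L'' \<or> fits M N b L''" "L - a = {q} \<and> q \<in> L'' \<or> fits M N a L''" for L'' p q
      using that fits_atom[OF that(1) L(2) cb] fits_atom[OF that(1) L(1) ca] by blast
    obtain p q where pq: "p \<in> L' \<inter> b" "q \<in> L - a" using False by blast
    have sub: "p \<in> M \<times> N" "q \<in> M \<times> N" using lines_subset lines pq by blast+
    from lines consider
      (rr) i i' where "L = {i} \<times> N" "L' = {i'} \<times> N" "i \<noteq> i'"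
    | (cc) j j' where "L = M \<times> {j}" "L' = M \<times> {j'}" "j \<noteq> j'"
    | (rc) i j where "L = {i} \<times> N" "L' = M \<times> {j}" "i \<in> M" "j \<in> N"
    | (cr) i j where "L = M \<times> {j}" "L' = {i} \<times> N" "i \<in> M" "j \<in> N"
    | (eq) "L = L'"
      unfolding lines_def by blast
    then show ?thesis
    proof cases
      \<comment> \<open>On distinct rows orthogonal cells share a column. Hence
        \<open>L' \<inter> b\<close> and \<open>L - a\<close> are single cells in one column, which
        carries both elements.\<close>
      case rr
      have "snd p' = snd q'" if "p' \<in> L' \<inter> b" "q' \<in> L - a" for p' q'
        using orth[OF that] that rr by auto
      note same = this
      have "p' = p" if "p' \<in> L' \<inter> b" for p'
        using same[OF that pq(2)] same[OF pq] that pq(1) rr(2) by (auto simp: prod_eq_iff)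
      moreover have "q' = q" if "q' \<in> L - a" for q'
        using same[OF pq(1) that] same[OF pq] that pq(2) rr(1) by (auto simp: prod_eq_iff)
      ultimately have "L' \<inter> b = {p}" "L - a = {q}" "snd p = snd q"
        using pq same[OF pq] by blast+
      moreover have "M \<times> {snd p} \<in> lines M N" "p \<in> M \<times> {snd p}" using sub(1) by (auto simp: lines_def)
      moreover from calculation(3) have "q \<in> M \<times> {snd p}" using sub(2) by auto
      ultimately show ?thesis by (intro atom[of "M \<times> {snd p}" p q]) simp_all
    next
      case cc
      have "fst p' = fst q'" if "p' \<in> L' \<inter> b" "q' \<in> L - a" for p' q'
        using orth[OF that] that cc by auto
      note same = this
      have "p' = p" if "p' \<in> L' \<inter> b" for p'
        using same[OF that pq(2)] same[OF pq] that pq(1) cc(2) by (auto simp: prod_eq_iff)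
      moreover have "q' = q" if "q' \<in> L - a" for q'
        using same[OF pq(1) that] same[OF pq] that pq(2) cc(1) by (auto simp: prod_eq_iff)
      ultimately have "L' \<inter> b = {p}" "L - a = {q}" "fst p = fst q"
        using pq same[OF pq] by blast+
      moreover have "{fst p} \<times> N \<in> lines M N" "p \<in> {fst p} \<times> N" using sub(1) by (auto simp: lines_def)
      moreover from calculation(3) have "q \<in> {fst p} \<times> N" using sub(2) by auto
      ultimately show ?thesis by (intro atom[of "{fst p} \<times> N" p q]) simp_all
    next
      \<comment> \<open>Exactly one cell of each orthogonal pair is the crossing
        \<open>(i, j)\<close>. So \<open>L' \<inter> b\<close> or \<open>L - a\<close> consists of
        the crossing alone, and the element concerned is carried by both lines.\<close>
      case rc
      have o: "(p' = (i, j)) \<noteq> (q' = (i, j))" if "p' \<in> L' \<inter> b" "q' \<in> L - a" for p' q'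
        using orth[OF that] that rc by (auto simp: prod_eq_iff)
      then consider "L' \<inter> b = {(i, j)}" | "L - a = {(i, j)}" using pq by blast
      then show ?thesis
      proof cases
        case 1
        moreover have "(i, j) \<in> L" using rc by simp
        ultimately show ?thesis using atom[OF lines(1), of "(i, j)" q] L(1) by blast
      next
        case 2
        moreover have "(i, j) \<in> L'" using rc by simp
        ultimately show ?thesis using atom[OF lines(2), of p "(i, j)"] L(2) by blast
      qed
    next
      case cr
      have o: "(p' = (i, j)) \<noteq> (q' = (i, j))" if "p' \<in> L' \<inter> b" "q' \<in> L - a" for p' q'
        using orth[OF that] that cr by (auto simp: prod_eq_iff)
      then consider "L' \<inter> b = {(i, j)}" | "L - a = {(i, j)}" using pq by blast
      then show ?thesis
      proof cases
        case 1
        moreover have "(i, j) \<in> L" using cr by simp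
        ultimately show ?thesis using atom[OF lines(1), of "(i, j)" q] L(1) by blast
      next
        case 2
        moreover have "(i, j) \<in> L'" using cr by simp
        ultimately show ?thesis using atom[OF lines(2), of p "(i, j)"] L(2) by blast
      qed
    next
      case eq
      then show ?thesis using L by blast
    qed
  qed
qed

text \<open>Closed sets are stable under intersection, and on a line carrying both \<open>a\<close>
  and \<open>b\<close> the trace of the result is the difference of the two traces, hence again
  finite or cofinite.\<close>

lemma minus_elements:
  assumes a: "a \<in> elements M N" and b: "b \<in> elements M N" and ba: "b \<subseteq> a"
  shows "a \<inter> b\<^sup>\<bottom> \<in> elements M N"
proof -
  obtain L where L: "fits M N a L" "fits M N b L" using common_line[OF assms] by blast
  note ca = elements_closed[OF a] and cb = elements_closed[OF b]
  let ?c = "a \<inter> b\<^sup>\<bottom>"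
  have up: "a\<^sup>\<bottom> \<subseteq> ?c\<^sup>\<bottom>" "b\<^sup>\<bottom>\<^sup>\<bottom> \<subseteq> ?c\<^sup>\<bottom>" by (rule perp_antimono; blast)+
  have "?c\<^sup>\<bottom>\<^sup>\<bottom> \<subseteq> a\<^sup>\<bottom>\<^sup>\<bottom>" "?c\<^sup>\<bottom>\<^sup>\<bottom> \<subseteq> b\<^sup>\<bottom>\<^sup>\<bottom>\<^sup>\<bottom>" 
    using perp_antimono[OF up(1), of M N] perp_antimono[OF up(2), of M N] by blast+
  moreover have "?c \<subseteq> ?c\<^sup>\<bottom>\<^sup>\<bottom>" using elements_subset[OF a] by (intro perp_perp_subset) blast
  ultimately have "?c\<^sup>\<bottom>\<^sup>\<bottom> = ?c" unfolding ca cb by blast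
  moreover have "fits M N ?c L" using L up unfolding fits_def cb by blast
  moreover have "finite (L \<inter> ?c) \<or> finite (L - ?c)"
  proof -
    have "L \<inter> ?c = (L \<inter> a) \<inter> (L - b)" "L - ?c = (L - a) \<union> (L \<inter> b)"
      using L(2) perp_disjoint[of b M N] by (auto simp: fits_def)
    then show ?thesis using fits_finite_or_cofinite[OF a L(1)] fits_finite_or_cofinite[OF b L(2)] by auto
  qed
  ultimately show ?thesis using elements_iff by blast
qed

text \<open>The join is reduced to subtraction: take \<open>a\<close> from the orthocomplement of
  \<open>b\<close> and form the orthocomplement of the result.\<close>

lemma partial_algebra_grid: "partial_algebra \<sigma> (grid M N)"
proof -
  have "(a\<^sup>\<bottom> \<inter> b\<^sup>\<bottom>)\<^sup>\<bottom> \<in> elements M N" if "a \<in> elements M N" "b \<in> elements M N" "a \<subseteq> b\<^sup>\<bottom>" for a b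
    using perp_elements[OF minus_elements[OF perp_elements[OF that(2)] that(1,3)]] by (simp add: Int_commute)
  then show ?thesis
    using minus_elements empty_elements by (auto simp: partial_algebra_def)
qed

end

section \<open>Representations of grid algebras\<close>

definition hits :: "'m set \<Rightarrow> ('m \<Rightarrow> 'n) \<Rightarrow> ('m \<times> 'n) set \<Rightarrow> bool" where
  "hits M f a \<longleftrightarrow> (\<exists>i\<in>M. (i, f i) \<in> a)"

text \<open>The points are bijections from \<open>M\<close> to \<open>N\<close>, in two copies; the
  function of \<open>a\<close> leads from the first copy to the second where the graph meets
  \<open>a\<close>. No second copy lies in a domain, so all compositions are empty, as in
  \<open>grid\<close>.\<close>

definition grid_rep :: "'m set \<Rightarrow> 'n set \<Rightarrow> ('m \<times> 'n) set \<Rightarrow> (('m \<Rightarrow> 'n) \<times> bool) pfun" where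
  "grid_rep M N a = {((f, False), (f, True)) | f. bij_betw f M N \<and> hits M f a}"

lemma representationD:
  assumes "representation \<sigma> A \<theta>"
  shows "inj_on \<theta> (carrier A)"
    and "DMinus \<in> \<sigma> \<Longrightarrow> a \<in> carrier A \<Longrightarrow> b \<in> carrier A \<Longrightarrow>
      map_option \<theta> (dminus A a b) = subset_compl (\<theta> a) (\<theta> b)"
  using assms by (auto simp: representation_def isomorphism_def pfun_palg_def bij_betw_def)

lemma hits_line:
  assumes "bij_betw f M N" "L \<in> lines M N"
  shows "hits M f L"
  using assms by (auto simp: lines_def hits_def bij_betw_def image_iff)

text \<open>Two cells on the graph of a bijection agree in both coordinates or in none, so they are
  never orthogonal.\<close>

lemma graph_perp:
  assumes "bij_betw f M N" "i \<in> M" "i' \<in> M" "(i, f i) \<in> a" "(i', f i') \<in> perp M N a"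
  shows False
proof -
  have "f i' = f i \<longleftrightarrow> i' = i" using assms(1-3) by (auto simp: bij_betw_def dest: inj_onD)
  then show False using assms(4,5) by (auto simp: perp_def)
qed

text \<open>The assumption \<open>eq\<close> says that the two cells are not orthogonal. Two
  transpositions correct the values of \<open>h\<close>, one for each cell; by \<open>eq\<close> and
  injectivity the second leaves the first correction in place.\<close>

lemma bij_betw_through:
  assumes h: "bij_betw h M N" and p: "(i, j) \<in> M \<times> N" and q: "(i', j') \<in> M \<times> N"
    and eq: "i = i' \<longleftrightarrow> j = j'"
  shows "\<exists>f. bij_betw f M N \<and> f i = j \<and> f i' = j'"
proof -
  have swap: "bij_betw (transpose x y \<circ> f) M N" if "bij_betw f M N" "x \<in> N" "y \<in> N" for f x y
    using that bij_betw_trans[OF that(1), of "transpose x y" N] by simp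
  define f1 where "f1 = transpose (h i) j \<circ> h"
  have f1: "bij_betw f1 M N" unfolding f1_def using h p by (intro swap) (auto simp: bij_betw_def)
  define f where "f = transpose (f1 i') j' \<circ> f1"
  have f: "bij_betw f M N" unfolding f_def using f1 q by (intro swap) (auto simp: bij_betw_def)
  have "f1 i = j" by (simp add: f1_def)
  moreover have "f1 i' = f1 i \<longleftrightarrow> i' = i" using f1 p q by (auto simp: bij_betw_def dest: inj_onD)
  ultimately have "f i = j" using eq by (auto simp: f_def transpose_def)
  then show ?thesis using f by (auto simp: f_def)
qed

context large_grid
begin

text \<open>The graph meets every line, so on one carrying \<open>a\<close> it meets
  \<open>a\<close> or its orthocomplement; it cannot meet both since no two of its cells are
  orthogonal.\<close>

lemma hits_perp:
  assumes a: "a \<in> elements M N" and f: "bij_betw f M N"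
  shows "hits M f (a\<^sup>\<bottom>) \<longleftrightarrow> \<not> hits M f a"
proof -
  obtain L where L: "fits M N a L" using elements_fits[OF a] by blast
  then have "hits M f L" using hits_line[OF f] by (simp add: fits_def)
  then have "hits M f a \<or> hits M f (a\<^sup>\<bottom>)" using L by (auto simp: fits_def hits_def)
  then show ?thesis using graph_perp[OF f] by (auto simp: hits_def)
qed

lemma hits_minus:
  assumes a: "a \<in> elements M N" and b: "b \<in> elements M N" and ba: "b \<subseteq> a" and f: "bij_betw f M N"
  shows "hits M f (a \<inter> b\<^sup>\<bottom>) \<longleftrightarrow> hits M f a \<and> \<not> hits M f b"
proof
  assume "hits M f (a \<inter> b\<^sup>\<bottom>)"
  then have "hits M f a" "hits M f (b\<^sup>\<bottom>)" by (auto simp: hits_def)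
  then show "hits M f a \<and> \<not> hits M f b" using hits_perp[OF b f] by simp
next
  assume *: "hits M f a \<and> \<not> hits M f b"
  \<comment> \<open>As the graph meets \<open>a\<close>, its cell on a common line cannot lie in the
    orthocomplement of \<open>a\<close>, so it lies in \<open>a\<close>; being outside
    \<open>b\<close>, it lies in the orthocomplement of \<open>b\<close>.\<close>
  obtain L where L: "fits M N a L" "fits M N b L" using common_line[OF a b ba] by blast
  then have "hits M f L" using hits_line[OF f] by (simp add: fits_def)
  then obtain i where i: "i \<in> M" "(i, f i) \<in> L" by (auto simp: hits_def)
  have "(i, f i) \<notin> a\<^sup>\<bottom>" using * graph_perp[OF f _ i(1)] by (auto simp: hits_def)
  moreover have "(i, f i) \<notin> b" using * i(1) by (auto simp: hits_def)
  ultimately show "hits M f (a \<inter> b\<^sup>\<bottom>)" using i L by (auto simp: fits_def hits_def)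
qed

text \<open>A cell of \<open>b\<close> outside the closed set \<open>a\<close> has a non-orthogonal
  partner in the orthocomplement of \<open>a\<close>. Starting from \<open>h\<close>, there is a
  bijection through both cells, and it hits \<open>b\<close> but not \<open>a\<close>.\<close>

lemma grid_rep_subset_iff:
  assumes h: "bij_betw h M N" and a: "a \<in> elements M N" and b: "b \<in> elements M N"
  shows "grid_rep M N b \<subseteq> grid_rep M N a \<longleftrightarrow> b \<subseteq> a"
proof
  assume sub: "grid_rep M N b \<subseteq> grid_rep M N a"
  show "b \<subseteq> a"
  proof (rule ccontr)
    assume "\<not> b \<subseteq> a"
    then obtain i j where p: "(i, j) \<in> b" "(i, j) \<notin> a" by auto
    have pM: "(i, j) \<in> M \<times> N" using p(1) elements_subset[OF b] by blast
    have "(i, j) \<notin> a\<^sup>\<bottom>\<^sup>\<bottom>" using p(2) elements_closed[OF a] by simp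
    then obtain i' j' where q: "(i', j') \<in> a\<^sup>\<bottom>" "i = i' \<longleftrightarrow> j = j'"
      using pM unfolding perp_def[of M N "a\<^sup>\<bottom>"] by blast
    obtain f where f: "bij_betw f M N" "f i = j" "f i' = j'"
      using bij_betw_through[OF h pM _ q(2)] q(1) perp_subset by blast
    have "hits M f b" "hits M f (a\<^sup>\<bottom>)"
      using f p q(1) pM perp_subset[of M N a] by (auto simp: hits_def)
    then have "((f, False), (f, True)) \<in> grid_rep M N b - grid_rep M N a"
      using hits_perp[OF a f(1)] f(1) by (auto simp: grid_rep_def)
    then show False using sub by blast
  qed
qed (auto simp: grid_rep_def hits_def)

text \<open>Subtraction is settled by \<open>hits_minus\<close>. Complements in the top element then
  reduce the join to subtraction, and its domain of definition to inclusion.\<close>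

lemma representation_grid_rep:
  assumes h: "bij_betw h M N"
  shows "representation \<sigma> (grid M N) (grid_rep M N)"
proof -
  let ?\<theta> = "grid_rep M N"
  let ?F = "?\<theta> ` elements M N"
  note sub = grid_rep_subset_iff[OF h]
  have minus: "?\<theta> (a \<inter> b\<^sup>\<bottom>) = ?\<theta> a - ?\<theta> b"
    if "a \<in> elements M N" "b \<in> elements M N" "b \<subseteq> a" for a b
    using hits_minus[OF that] by (auto simp: grid_rep_def)
  have perp: "?\<theta> (a\<^sup>\<bottom>) = ?\<theta> (M \<times> N) - ?\<theta> a" if "a \<in> elements M N" for a
    using minus[OF top_elements that elements_subset[OF that]] perp_subset[of M N a]
    by (simp add: Int_absorb1)
  have le_top: "?\<theta> a \<subseteq> ?\<theta> (M \<times> N)" if "a \<in> elements M N" for a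
    using sub[OF top_elements that] elements_subset[OF that] by blast
  have dom: "Domain (?\<theta> a) \<inter> Domain (?\<theta> b) = {} \<longleftrightarrow> a \<subseteq> b\<^sup>\<bottom>"
    if "a \<in> elements M N" "b \<in> elements M N" for a b
  proof -
    \<comment> \<open>All the functions are restrictions of a single one, so disjoint domains amount
      to disjointness.\<close>
    have "Domain (?\<theta> a) \<inter> Domain (?\<theta> b) = {} \<longleftrightarrow> ?\<theta> a \<inter> ?\<theta> b = {}"
      by (auto simp: grid_rep_def)
    also have "\<dots> \<longleftrightarrow> ?\<theta> a \<subseteq> ?\<theta> (b\<^sup>\<bottom>)"
      unfolding perp[OF that(2)] using le_top[OF that(1)] by blast
    finally show ?thesis using sub[OF perp_elements[OF that(2)] that(1)] by simp
  qed
  have join: "?\<theta> ((a\<^sup>\<bottom> \<inter> b\<^sup>\<bottom>)\<^sup>\<bottom>) = ?\<theta> a \<union> ?\<theta> b"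
    if "a \<in> elements M N" "b \<in> elements M N" "a \<subseteq> b\<^sup>\<bottom>" for a b
  proof -
    note b' = perp_elements[OF that(2)]
    have "?\<theta> ((b\<^sup>\<bottom> \<inter> a\<^sup>\<bottom>)\<^sup>\<bottom>) = ?\<theta> (M \<times> N) - (?\<theta> (M \<times> N) - ?\<theta> b - ?\<theta> a)"
      using perp[OF minus_elements[OF b' that(1,3)]] minus[OF b' that(1,3)] perp[OF that(2)] by simp
    then show ?thesis using le_top[OF that(1)] le_top[OF that(2)] by (auto simp: Int_commute)
  qed
  have inj: "inj_on ?\<theta> (elements M N)"
    using sub by (intro inj_onI) blast
  have comp: "?\<theta> a O ?\<theta> b = {}" for a b
    by (auto simp: grid_rep_def)
  have empty: "?\<theta> {} = {}"
    by (auto simp: grid_rep_def hits_def)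
  have iso: "isomorphism \<sigma> (grid M N) (pfun_palg ?F) ?\<theta>"
    unfolding isomorphism_def pfun_palg_def
    by (simp add: inj_on_imp_bij_betw[OF inj] dd_union_def subset_compl_def dom join minus sub comp empty)
  have "single_valued (?\<theta> a)" for a
    by (auto simp: single_valued_def grid_rep_def)
  then show ?thesis
    unfolding representation_def partial_algebra_of_pfuns_def
    using iso partial_algebra_isomorphism[OF partial_algebra_grid iso] by blast
qed

text \<open>Cells of \<open>a\<close> on one of the parallel lines are orthogonal to cells outside
  \<open>a\<close> on the other, hence face them. For a nontrivial \<open>a\<close>, both
  \<open>L \<inter> a\<close> and \<open>L - a\<close> would be single cells, although
  \<open>L\<close> has at least three.\<close>

lemma fits_parallel:
  assumes a: "a \<in> elements M N" and L: "fits M N a L" and L': "fits M N a L'"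
    and disj: "L \<inter> L' = {}" and L'': "L'' \<in> lines M N"
  shows "fits M N a L''"
proof (rule ccontr)
  assume "\<not> ?thesis"
  then have ne: "L \<inter> a \<noteq> {}" "L - a \<noteq> {}" "L' \<inter> a \<noteq> {}" "L' - a \<noteq> {}"
    using fits_trivial[OF L'' L elements_closed[OF a]] fits_trivial[OF L'' L' elements_closed[OF a]] by blast+
  have orth: "(fst p = fst q) \<noteq> (snd p = snd q)"
    if "p \<in> (L \<union> L') \<inter> a" "q \<in> (L \<union> L') - a" for p q
  proof -
    have "q \<in> a\<^sup>\<bottom>" using that L L' by (auto simp: fits_def)
    then show ?thesis using that by (force simp: perp_def)
  qed
  obtain p q p' q' where pq: "p \<in> L \<inter> a" "q \<in> L - a" "p' \<in> L' \<inter> a" "q' \<in> L' - a"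
    using ne by blast
  have "L \<in> lines M N" "L' \<in> lines M N" using L L' by (auto simp: fits_def)
  then consider (rr) i i' where "L = {i} \<times> N" "L' = {i'} \<times> N" "i \<noteq> i'"
    | (cc) j j' where "L = M \<times> {j}" "L' = M \<times> {j'}" "j \<noteq> j'"
    using disj pq unfolding lines_def by blast
  then show False
  proof cases
    case rr
    have 1: "snd r = snd q'" if "r \<in> L \<inter> a" for r using orth[of r q'] that pq rr by auto
    have 2: "snd r = snd p'" if "r \<in> L - a" for r using orth[of p' r] that pq rr by auto
    obtain r where "r \<in> L" "r \<noteq> (i, snd q')" "r \<noteq> (i, snd p')"
      using large_line \<open>L \<in> lines M N\<close> by blast
    then show False using 1[of r] 2[of r] rr by (auto simp: prod_eq_iff)
  next
    case cc
    have 1: "fst r = fst q'" if "r \<in> L \<inter> a" for r using orth[of r q'] that pq cc by auto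
    have 2: "fst r = fst p'" if "r \<in> L - a" for r using orth[of p' r] that pq cc by auto
    obtain r where "r \<in> L" "r \<noteq> (fst q', j)" "r \<noteq> (fst p', j)"
      using large_line \<open>L \<in> lines M N\<close> by blast
    then show False using 1[of r] 2[of r] cc by (auto simp: prod_eq_iff)
  qed
qed

text \<open>
  A Helly property of the lines carrying an element: there are at most one horizontal and one
  vertical one, unless the element is trivial.
\<close>

lemma pairwise_common_line:
  assumes S: "S \<subseteq> elements M N"
    and pw: "\<And>s t. s \<in> S \<Longrightarrow> t \<in> S \<Longrightarrow> \<exists>L. fits M N s L \<and> fits M N t L"
  shows "\<exists>L. L \<in> lines M N \<and> (\<forall>s\<in>S. fits M N s L)"
proof (rule ccontr)
  assume no: "\<not> ?thesis"
  have row: "\<exists>s\<in>S. \<not> fits M N s ({i} \<times> N)" if "i \<in> M" for i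
    using no that unfolding lines_def by blast
  have col: "\<exists>s\<in>S. \<not> fits M N s (M \<times> {j})" if "j \<in> N" for j
    using no that unfolding lines_def by blast
  have row_unique: "i = i'"
    if "s \<in> S" "fits M N s ({i} \<times> N)" "fits M N s ({i'} \<times> N)" "L \<in> lines M N" "\<not> fits M N s L" for s i i' L
    using fits_parallel[OF _ that(2,3) _ that(4)] that(1,5) S by blast
  have col_unique: "j = j'"
    if "s \<in> S" "fits M N s (M \<times> {j})" "fits M N s (M \<times> {j'})" "L \<in> lines M N" "\<not> fits M N s L" for s j j' L
    using fits_parallel[OF _ that(2,3) _ that(4)] that(1,5) S by blast
  \<comment> \<open>A nontrivial \<open>s\<close> carried by row \<open>i\<close> leads to a
    triangle: \<open>t\<close>, which avoids the row, can share only a column \<open>j\<close> with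
    \<open>s\<close>; \<open>u\<close>, which avoids that column, can share only row
    \<open>i\<close> with \<open>s\<close>. A line shared by \<open>t\<close> and \<open>u\<close>
    would be a second row for \<open>u\<close> or a second column for \<open>t\<close>.\<close>
  have rows: False if s: "s \<in> S" "L0 \<in> lines M N" "\<not> fits M N s L0" and i: "i \<in> M" "fits M N s ({i} \<times> N)" for s L0 i
  proof -
    obtain t where t: "t \<in> S" "\<not> fits M N t ({i} \<times> N)" using row[OF i(1)] by blast
    obtain L where L: "fits M N s L" "fits M N t L" using pw s(1) t(1) by blast
    have "L \<noteq> {i'} \<times> N" for i' using row_unique[OF s(1) i(2) _ s(2,3)] L t(2) by metis
    then obtain j where j: "j \<in> N" "L = M \<times> {j}" using L(1) unfolding fits_def lines_def by blast
    obtain u where u: "u \<in> S" "\<not> fits M N u (M \<times> {j})" using col[OF j(1)] by blast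
    have lines: "{i} \<times> N \<in> lines M N" "M \<times> {j} \<in> lines M N" using i(1) j(1) by (auto simp: lines_def)
    obtain L' where L': "fits M N s L'" "fits M N u L'" using pw s(1) u(1) by blast
    have "L' \<noteq> M \<times> {j'}" for j' using col_unique[OF s(1) _ _ s(2,3), of j' j] L' L(1) j(2) u(2) by metis
    then obtain i' where "L' = {i'} \<times> N" using L'(1) unfolding fits_def lines_def by blast
    then have u_i: "fits M N u ({i} \<times> N)" using row_unique[OF s(1) i(2) _ s(2,3)] L' by metis
    obtain L'' where L'': "fits M N t L''" "fits M N u L''" using pw t(1) u(1) by blast
    then have "L'' \<in> lines M N" by (simp add: fits_def)
    then consider i' where "L'' = {i'} \<times> N" | j' where "L'' = M \<times> {j'}" unfolding lines_def by blast
    then show False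
    proof cases
      case 1
      then show False using row_unique[OF u(1) u_i _ lines(2) u(2)] L'' t(2) by metis
    next
      case 2
      then show False using col_unique[OF t(1) _ _ lines(1) t(2), of j' j] L'' L(2) j(2) u(2) by metis
    qed
  qed
  obtain i0 where "i0 \<in> M" using large_M by blast
  then have L0: "{i0} \<times> N \<in> lines M N" (is "?L0 \<in> _") by (auto simp: lines_def)
  with no obtain s where s: "s \<in> S" "\<not> fits M N s ?L0" by metis
  obtain L where L: "fits M N s L" using pw[OF s(1) s(1)] by blast
  \<comment> \<open>No row carries \<open>s\<close>, so a column \<open>j\<close> does; a line
    shared with some \<open>t\<close> avoiding that column would be a row after all.\<close>
  have "L \<noteq> {i} \<times> N" if "i \<in> M" for i using rows[OF s(1) L0 s(2) that] L by blast
  then obtain j where j: "j \<in> N" "L = M \<times> {j}" using L unfolding fits_def lines_def by blast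
  obtain t where t: "t \<in> S" "\<not> fits M N t (M \<times> {j})" using col[OF j(1)] by blast
  obtain L' where L': "fits M N s L'" "fits M N t L'" using pw s(1) t(1) by blast
  have "L' \<noteq> M \<times> {j'}" for j' using col_unique[OF s(1) _ _ L0 s(2), of j' j] L' L j(2) t(2) by metis
  then obtain i where "i \<in> M" "L' = {i} \<times> N" using L'(1) unfolding fits_def lines_def by blast
  then show False using rows[OF s(1) L0 s(2)] L'(1) by blast
qed

text \<open>Distinct members of a combinable set are orthogonal and so share a line; by the Helly
  property one line \<open>L\<close> carries all members. If a graph meets no member, its cell on
  \<open>L\<close> lies in the orthocomplement of each, so the orthocomplement of this cell is an
  upper bound. The supremum is below it and is missed by the graph too.\<close>

lemma complete_representation_grid_rep:
  assumes h: "bij_betw h M N"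
  shows "complete_representation \<sigma> (grid M N) (grid_rep M N)"
  unfolding complete_representation_def
proof (intro conjI allI impI representation_grid_rep[OF h])
  fix S a assume S: "S \<subseteq> carrier (grid M N)" "pairwise_combinable (grid M N) S" "is_supremum (grid M N) S a"
  have le: "lesssim (grid M N) x y \<longleftrightarrow> x \<subseteq> y" for x y
    by (auto simp: lesssim_def)
  have sup: "a \<in> elements M N" "\<And>s. s \<in> S \<Longrightarrow> s \<subseteq> a"
    "\<And>b. b \<in> elements M N \<Longrightarrow> (\<And>s. s \<in> S \<Longrightarrow> s \<subseteq> b) \<Longrightarrow> a \<subseteq> b"
    using S(3) unfolding is_supremum_def le by auto
  have "\<exists>L. fits M N s L \<and> fits M N t L" if st: "s \<in> S" "t \<in> S" for s t
  proof (cases "s = t")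
    case True
    then show ?thesis using elements_fits[of s M N] S(1) st by auto
  next
    case False
    then obtain u where "dminus (grid M N) u s = Some t"
      using S(2) st unfolding pairwise_combinable_def by blast
    then have "t \<subseteq> s\<^sup>\<bottom>" by (auto split: if_splits)
    moreover have el: "s \<in> elements M N" "t \<in> elements M N" using S(1) st by auto
    ultimately show ?thesis
      using common_line[OF perp_elements[OF el(1)] el(2)] fits_perp[OF elements_closed[OF el(1)]] by blast
  qed
  then obtain L where L: "L \<in> lines M N" "\<forall>s\<in>S. fits M N s L"
    using pairwise_common_line[of S] S(1) by auto
  have "\<exists>s\<in>S. hits M f s" if f: "bij_betw f M N" and fa: "hits M f a" for f
  proof (rule ccontr)
    assume no: "\<not> (\<exists>s\<in>S. hits M f s)"
    obtain i where i: "i \<in> M" "(i, f i) \<in> L" using hits_line[OF f L(1)] by (auto simp: hits_def)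
    let ?p = "(i, f i)"
    have pM: "{?p} \<subseteq> M \<times> N" using i lines_subset[OF L(1)] by blast
    have "s \<subseteq> {?p}\<^sup>\<bottom>" if "s \<in> S" for s
    proof -
      have "?p \<notin> s" using no that i(1) by (auto simp: hits_def)
      then have "{?p} \<subseteq> s\<^sup>\<bottom>" using L(2) that i(2) by (auto simp: fits_def)
      moreover have "s \<subseteq> M \<times> N" using S(1) that elements_subset[of s M N] by auto
      ultimately show ?thesis using subset_perp_commute[OF pM] by blast
    qed
    moreover have "{?p} \<in> strips M N" using i(2) by (intro strips_line[OF L(1)]) auto
    then have "{?p}\<^sup>\<bottom> \<in> elements M N" by (simp add: elements_def)
    ultimately have "a \<subseteq> {?p}\<^sup>\<bottom>" by (intro sup(3))
    then show False using fa graph_perp[OF f i(1), of _ "{?p}"] by (auto simp: hits_def)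
  qed
  then have "grid_rep M N a \<subseteq> (\<Union>s\<in>S. grid_rep M N s)"
    by (auto simp: grid_rep_def)
  moreover have "grid_rep M N s \<subseteq> grid_rep M N a" if "s \<in> S" for s
    using sup(2)[OF that] by (auto simp: grid_rep_def hits_def)
  ultimately show "grid_rep M N a = (\<Union>s\<in>S. grid_rep M N s)" by blast
qed

lemma strip_singleton: "p \<in> M \<times> N \<Longrightarrow> {p} \<in> strips M N"
  by (cases p) (auto intro!: strips_line[of "{fst p} \<times> N"] simp: lines_def)

end

section \<open>Bijections recovered from representations\<close>

locale represented_grid = large_grid M N for M :: "'m set" and N :: "'n set" +
  fixes \<sigma> :: "sym set" and \<theta> :: "('m \<times> 'n) set \<Rightarrow> 'x pfun"
  assumes rep: "representation \<sigma> (grid M N) \<theta>" and DMinus: "DMinus \<in> \<sigma>"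
begin

lemma rep_minus:
  assumes "a \<in> elements M N" "b \<in> elements M N" "b \<subseteq> a"
  shows "\<theta> (a \<inter> b\<^sup>\<bottom>) = \<theta> a - \<theta> b" "\<theta> b \<subseteq> \<theta> a"
  using representationD(2)[OF rep DMinus, of a b] assms by (auto simp: subset_compl_def split: if_splits)

text \<open>Comes from subtracting \<open>{}\<close> from itself, as \<open>\<sigma>\<close> may
  lack \<open>Zero\<close>.\<close>

lemma rep_empty: "\<theta> {} = {}"
  using rep_minus(1)[OF empty_elements empty_elements] by auto

lemma atom_elements: "p \<in> M \<times> N \<Longrightarrow> {p}\<^sup>\<bottom> \<in> elements M N" "p \<in> M \<times> N \<Longrightarrow> {p}\<^sup>\<bottom>\<^sup>\<bottom> \<in> elements M N"
  using strip_singleton by (auto simp: elements_def)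

lemma rep_perp_atom:
  assumes "p \<in> M \<times> N"
  shows "\<theta> ({p}\<^sup>\<bottom>) = \<theta> (M \<times> N) - \<theta> ({p}\<^sup>\<bottom>\<^sup>\<bottom>)"
proof -
  have "M \<times> N \<inter> {p}\<^sup>\<bottom>\<^sup>\<bottom>\<^sup>\<bottom> = {p}\<^sup>\<bottom>"
    using perp_perp_perp[of "{p}" M N] assms perp_subset[of M N "{p}"] by auto
  then show ?thesis using rep_minus(1)[OF top_elements atom_elements(2)[OF assms] perp_subset] by simp
qed

lemma atom_subset_perp:
  assumes "X \<subseteq> M \<times> N" "p \<in> X\<^sup>\<bottom>"
  shows "{p}\<^sup>\<bottom>\<^sup>\<bottom> \<subseteq> X\<^sup>\<bottom>"
proof -
  have "X\<^sup>\<bottom>\<^sup>\<bottom> \<subseteq> {p}\<^sup>\<bottom>" using assms(2) by (intro perp_antimono) auto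
  then have "{p}\<^sup>\<bottom>\<^sup>\<bottom> \<subseteq> X\<^sup>\<bottom>\<^sup>\<bottom>\<^sup>\<bottom>" by (rule perp_antimono)
  then show ?thesis using perp_perp_perp[OF assms(1)] by simp
qed

text \<open>The third assumption says that the two cells are orthogonal. One atom is then below the
  orthocomplement of the other, whose image \<open>rep_perp_atom\<close> computes.\<close>

lemma rep_atoms_disjoint:
  assumes "(i, j) \<in> M \<times> N" "(i', j') \<in> M \<times> N" "i = i' \<longleftrightarrow> j \<noteq> j'"
  shows "\<theta> ({(i, j)}\<^sup>\<bottom>\<^sup>\<bottom>) \<inter> \<theta> ({(i', j')}\<^sup>\<bottom>\<^sup>\<bottom>) = {}"
proof -
  have "(i', j') \<in> {(i, j)}\<^sup>\<bottom>" using assms by (auto simp: perp_def)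
  then have "{(i', j')}\<^sup>\<bottom>\<^sup>\<bottom> \<subseteq> {(i, j)}\<^sup>\<bottom>" using assms(1) by (intro atom_subset_perp) auto
  then have "\<theta> ({(i', j')}\<^sup>\<bottom>\<^sup>\<bottom>) \<subseteq> \<theta> ({(i, j)}\<^sup>\<bottom>)"
    using atom_elements assms(1,2) by (intro rep_minus(2)) auto
  then show ?thesis using rep_perp_atom[OF assms(1)] by blast
qed

text \<open>The cells are peeled off one by one: each step splits the image of
  \<open>perp M N F\<close> into that of the atom of \<open>p\<close> and that of
  \<open>perp M N (insert p F)\<close>. After the last cell, \<open>perp_line\<close> leaves
  nothing.\<close>

lemma finite_line_cover:
  assumes L: "L \<in> lines M N" "finite L"
  shows "\<theta> (M \<times> N) \<subseteq> (\<Union>p\<in>L. \<theta> ({p}\<^sup>\<bottom>\<^sup>\<bottom>))"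
proof -
  have "\<theta> (M \<times> N) \<subseteq> \<theta> (F\<^sup>\<bottom>) \<union> (\<Union>p\<in>F. \<theta> ({p}\<^sup>\<bottom>\<^sup>\<bottom>))" if "F \<subseteq> L" for F
    using finite_subset[OF that L(2)] that
  proof (induction F rule: finite_induct)
    case empty
    then show ?case by (simp add: perp_empty)
  next
    case (insert p F)
    have pM: "p \<in> M \<times> N" and F: "F \<subseteq> M \<times> N" using insert.prems lines_subset[OF L(1)] by auto
    have "F \<in> strips M N" using insert by (intro strips_line[OF L(1)]) auto
    then have el: "F\<^sup>\<bottom> \<in> elements M N" by (simp add: elements_def)
    have "p \<in> F\<^sup>\<bottom>" using line_minus_subset_perp[OF L(1), of F] insert by blast
    then have sub: "{p}\<^sup>\<bottom>\<^sup>\<bottom> \<subseteq> F\<^sup>\<bottom>" by (rule atom_subset_perp[OF F])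
    have "(insert p F)\<^sup>\<bottom> = F\<^sup>\<bottom> \<inter> {p}\<^sup>\<bottom>" by (auto simp: perp_def)
    also have "{p}\<^sup>\<bottom> = {p}\<^sup>\<bottom>\<^sup>\<bottom>\<^sup>\<bottom>" using perp_perp_perp[of "{p}" M N] pM by simp
    finally have "\<theta> ((insert p F)\<^sup>\<bottom>) = \<theta> (F\<^sup>\<bottom>) - \<theta> ({p}\<^sup>\<bottom>\<^sup>\<bottom>)"
      using rep_minus(1)[OF el atom_elements(2)[OF pM] sub] by simp
    then show ?case using insert.IH insert.prems by auto
  qed
  from this[OF order_refl] show ?thesis using perp_line[OF L(1)] rep_empty by simp
qed

text \<open>The atoms of \<open>L\<close> are combinable with supremum \<open>M \<times> N\<close>:
  an upper bound contains \<open>L\<close>, so by \<open>perp_line\<close> its orthocomplement is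
  empty. Completeness turns this into a cover, even on an infinite line.\<close>

lemma complete_line_cover:
  assumes c: "complete_representation \<sigma> (grid M N) \<theta>" and L: "L \<in> lines M N"
  shows "\<theta> (M \<times> N) \<subseteq> (\<Union>p\<in>L. \<theta> ({p}\<^sup>\<bottom>\<^sup>\<bottom>))"
proof -
  let ?S = "(\<lambda>p. {p}\<^sup>\<bottom>\<^sup>\<bottom>) ` L"
  note LM = lines_subset[OF L]
  have "pairwise_combinable (grid M N) ?S"
    unfolding pairwise_combinable_def
  proof (intro ballI impI)
    fix s t assume "s \<in> ?S" "t \<in> ?S" and ne: "s \<noteq> t"
    then obtain p q where pq: "p \<in> L" "q \<in> L" "s = {p}\<^sup>\<bottom>\<^sup>\<bottom>" "t = {q}\<^sup>\<bottom>\<^sup>\<bottom>" "p \<noteq> q" by blast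
    \<comment> \<open>The join of the two atoms. Subtracting the first leaves an element with trace
      \<open>{q}\<close> on \<open>L\<close>, which is the second by
      \<open>fits_eq_perp_perp\<close>.\<close>
    let ?u = "{p, q}\<^sup>\<bottom>\<^sup>\<bottom>"
    let ?c = "?u \<inter> s\<^sup>\<bottom>"
    have PQ: "{p, q} \<subseteq> M \<times> N" using pq LM by auto
    have "{p, q} \<in> strips M N" using pq by (intro strips_line[OF L]) auto
    then have u: "?u \<in> elements M N" by (simp add: elements_def)
    have s: "s \<in> elements M N" using pq LM atom_elements(2) by blast
    have su: "s \<subseteq> ?u" unfolding pq by (intro perp_antimono) auto
    have c: "?c \<in> elements M N" by (rule minus_elements[OF u s su])
    have s_perp: "s\<^sup>\<bottom> = {p}\<^sup>\<bottom>" using perp_perp_perp[of "{p}" M N] PQ pq by simp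
    have ps: "p \<in> s" using perp_perp_subset[of "{p}" M N] PQ pq by simp
    have qu: "q \<in> ?u" using perp_perp_subset[OF PQ] by simp
    have qs: "q \<in> s\<^sup>\<bottom>" using line_minus_subset_perp[OF L, of "{p}"] pq unfolding s_perp by blast
    have rest: "L - {p, q} \<subseteq> {p, q}\<^sup>\<bottom>" using pq by (intro line_minus_subset_perp[OF L]) auto
    have "?u\<^sup>\<bottom> \<subseteq> ?c\<^sup>\<bottom>" "s\<^sup>\<bottom>\<^sup>\<bottom> \<subseteq> ?c\<^sup>\<bottom>" by (rule perp_antimono; blast)+
    then have up: "{p, q}\<^sup>\<bottom> \<subseteq> ?c\<^sup>\<bottom>" "s \<subseteq> ?c\<^sup>\<bottom>"
      using perp_perp_perp[OF PQ] elements_closed[OF s] by simp_all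
    have "fits M N ?c L" using L rest up ps qs qu unfolding fits_def by blast
    moreover have "L \<inter> ?c = {q}"
      using rest up ps qs qu pq perp_disjoint[of ?c M N] by blast
    ultimately have "?c = t"
      using fits_eq_perp_perp elements_closed[OF c] pq by metis
    then show "\<exists>u\<in>carrier (grid M N). dminus (grid M N) u s = Some t"
      using u su by (intro bexI[of _ ?u]) simp_all
  qed
  moreover have "is_supremum (grid M N) ?S (M \<times> N)"
    unfolding is_supremum_def
  proof (intro conjI ballI impI)
    show "M \<times> N \<in> carrier (grid M N)" using top_elements by simp
    show "lesssim (grid M N) s (M \<times> N)" if "s \<in> ?S" for s
      using that perp_subset by (fastforce simp: lesssim_def)
    fix b assume b: "b \<in> carrier (grid M N)" "\<forall>s\<in>?S. lesssim (grid M N) s b"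
    have "L \<subseteq> b"
    proof
      fix p assume p: "p \<in> L"
      then have "{p}\<^sup>\<bottom>\<^sup>\<bottom> \<subseteq> b" using b(2) by (force simp: lesssim_def split: if_splits)
      moreover have "{p} \<subseteq> {p}\<^sup>\<bottom>\<^sup>\<bottom>" using p LM by (intro perp_perp_subset) auto
      ultimately show "p \<in> b" by blast
    qed
    then have "b\<^sup>\<bottom> \<subseteq> L\<^sup>\<bottom>" by (rule perp_antimono)
    then have "b = M \<times> N" using perp_line[OF L] elements_closed[of b M N] b(1) perp_empty[of M N] by simp
    then show "lesssim (grid M N) (M \<times> N) b" by (simp add: lesssim_def)
  qed
  moreover have "?S \<subseteq> carrier (grid M N)" using atom_elements(2) LM by auto
  ultimately have "\<theta> (M \<times> N) = (\<Union>s\<in>?S. \<theta> s)" using c unfolding complete_representation_def by blast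
  then show ?thesis by simp
qed

text \<open>For a point \<open>x\<close> in the image of the top, the covers put \<open>x\<close>
  into some atom of each row and each column, and disjointness of orthogonal atoms makes it
  unique.\<close>

lemma bij_of_line_covers:
  assumes cover: "\<And>L. L \<in> lines M N \<Longrightarrow> \<theta> (M \<times> N) \<subseteq> (\<Union>p\<in>L. \<theta> ({p}\<^sup>\<bottom>\<^sup>\<bottom>))"
  shows "\<exists>f. bij_betw f M N"
proof -
  have "\<theta> (M \<times> N) \<noteq> \<theta> {}"
    using representationD(1)[OF rep] top_elements empty_elements top_nonempty
    by (auto dest: inj_onD)
  then obtain x where x: "x \<in> \<theta> (M \<times> N)" using rep_empty by blast
  define P where "P i j \<longleftrightarrow> x \<in> \<theta> ({(i, j)}\<^sup>\<bottom>\<^sup>\<bottom>)" for i j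
  have row: "\<exists>j\<in>N. P i j" if "i \<in> M" for i
    using cover[of "{i} \<times> N"] that x by (force simp: P_def lines_def)
  have col: "\<exists>i\<in>M. P i j" if "j \<in> N" for j
    using cover[of "M \<times> {j}"] that x by (force simp: P_def lines_def)
  have unique: "i = i' \<longleftrightarrow> j = j'" if "P i j" "P i' j'" "i \<in> M" "i' \<in> M" "j \<in> N" "j' \<in> N" for i i' j j'
    using rep_atoms_disjoint[of i j i' j'] that by (auto simp: P_def)
  obtain f where f: "\<And>i. i \<in> M \<Longrightarrow> f i \<in> N \<and> P i (f i)" using row by metis
  have "inj_on f M" using f unique by (intro inj_onI) metis
  moreover have "f ` M = N" using f unique col by (auto simp: image_iff) metis
  ultimately show ?thesis by (auto simp: bij_betw_def)
qed

end

section \<open>Elementary equivalence of grid algebras\<close>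

text \<open>Since \<^const>\<open>card\<close> is 0 on infinite sets, any two infinite sets are similar.\<close>

definition similar :: "nat \<Rightarrow> 'a set \<Rightarrow> 'b set \<Rightarrow> bool" where
  "similar k C D \<longleftrightarrow>
     (finite C \<longleftrightarrow> finite D) \<and> (card C = card D \<or> 2 ^ Suc k \<le> card C \<and> 2 ^ Suc k \<le> card D)"

text \<open>Not a cell of the grid but a colour class. In the game a colour records, newest choice
  first, which of the sets of rows (or of columns) chosen so far contain the point.\<close>

definition cell :: "'a set \<Rightarrow> ('a \<Rightarrow> bool list) \<Rightarrow> bool list \<Rightarrow> 'a set" where
  "cell M c q = {x \<in> M. c x = q}"

definition alike :: "nat \<Rightarrow> 'a set \<Rightarrow> ('a \<Rightarrow> bool list) \<Rightarrow> 'b set \<Rightarrow> ('b \<Rightarrow> bool list) \<Rightarrow> bool" where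
  "alike k M c M' c' \<longleftrightarrow> (\<forall>q. similar k (cell M c q) (cell M' c' q))"

text \<open>For alike colourings this says that \<open>a\<close> and \<open>a'\<close> are unions of
  products of colour classes, for the same pairs of colours.\<close>

definition matched where
  "matched M N c d M' N' c' d' a a' \<longleftrightarrow> a \<subseteq> M \<times> N \<and> a' \<subseteq> M' \<times> N' \<and>
     (\<forall>i\<in>M. \<forall>j\<in>N. \<forall>i'\<in>M'. \<forall>j'\<in>N'. c i = c' i' \<longrightarrow> d j = d' j' \<longrightarrow> ((i, j) \<in> a \<longleftrightarrow> (i', j') \<in> a'))"

section \<open>Colourings in the game\<close>

lemma alikeD: "alike k M c M' c' \<Longrightarrow> similar k (cell M c q) (cell M' c' q)"
  by (simp add: alike_def)

lemma similar_sym: "similar k C D \<Longrightarrow> similar k D C"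
  by (auto simp: similar_def)

lemma alike_sym: "alike k M c M' c' \<Longrightarrow> alike k M' c' M c"
  by (auto simp: alike_def similar_sym)

lemma alike_const:
  assumes "similar k M M'"
  shows "alike k M (\<lambda>_. []) M' (\<lambda>_. [])"
  unfolding alike_def
proof
  fix q
  show "similar k (cell M (\<lambda>_. []) q) (cell M' (\<lambda>_. []) q)"
    using assms by (cases "q = []") (simp_all add: cell_def similar_def)
qed

text \<open>The threshold \<open>2 ^ Suc k\<close> is at least 2, so the sizes 0 and 1 are matched
  exactly; for infinite sets both cards are the default 0.\<close>

lemma similar_small:
  assumes "similar k C D" "card C \<le> 1"
  shows "card D = card C"
proof -
  have "(2::nat) \<le> 2 ^ Suc k" by simp
  then have "\<not> 2 ^ Suc k \<le> card C" using assms(2) by linarith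
  then show ?thesis using assms(1) by (auto simp: similar_def)
qed

lemma similar_empty_iff:
  assumes "similar k C D"
  shows "C = {} \<longleftrightarrow> D = {}"
  using similar_small[OF assms] similar_small[OF similar_sym[OF assms]] assms
  by (auto simp: similar_def)

text \<open>One round halves the threshold. If finite \<open>C\<close> and \<open>D\<close> differ
  in size, both have at least twice the new threshold, so a part of \<open>C\<close> below it can be
  copied exactly while the other part stays above it.\<close>

lemma similar_split:
  assumes sim: "similar (Suc k) C D" and T: "T \<subseteq> C" "finite T"
  shows "\<exists>T'\<subseteq>D. finite T' \<and> similar k T T' \<and> similar k (C - T) (D - T')"
proof (cases "finite C")
  case False
  then have D: "infinite D" using sim by (simp add: similar_def)
  obtain T' where T': "T' \<subseteq> D" "finite T'" "card T' = card T"
    using infinite_arbitrarily_large[OF D] by blast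
  have "infinite (C - T)" "infinite (D - T')"
    using False D T(2) T'(2) by simp_all
  then show ?thesis using T T' by (auto simp: similar_def)
next
  case True
  then have D: "finite D" using sim by (simp add: similar_def)
  let ?h = "2 ^ Suc k :: nat"
  have CD: "card C = card D \<or> 2 * ?h \<le> card C \<and> 2 * ?h \<le> card D"
    using sim by (simp add: similar_def)
  have tC: "card T \<le> card C" using T True by (simp add: card_mono)
  \<comment> \<open>In order: copy the size of \<open>T\<close>, copy the size of
    \<open>C - T\<close>, or, when both parts are large, cut \<open>D\<close> so that both of its
    parts are large.\<close>
  define t where "t = (if card C = card D \<or> card T < ?h then card T
    else if card C - card T < ?h then card D - (card C - card T) else ?h)"
  have t: "t \<le> card D" "card T = t \<or> ?h \<le> card T \<and> ?h \<le> t"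
    "card C - card T = card D - t \<or> ?h \<le> card C - card T \<and> ?h \<le> card D - t"
    using CD tC unfolding t_def by (auto split: if_splits)
  obtain T' where T': "T' \<subseteq> D" "card T' = t"
    using obtain_subset_with_card_n[OF t(1)] by blast
  then have "finite T'" using D finite_subset by blast
  moreover have "card (C - T) = card C - card T" "card (D - T') = card D - t"
    using T T' D \<open>finite T'\<close> by (simp_all add: card_Diff_subset)
  ultimately show ?thesis
    using T T' True D t(2,3) by (intro exI[of _ T']) (simp add: similar_def)
qed

text \<open>Every colour class is split separately by \<open>similar_split\<close>. Singletons are
  answered by singletons, so that the reply to a strip is a strip.\<close>

lemma alike_extend:
  assumes al: "alike (Suc k) M c M' c'" and A: "A \<subseteq> M" "finite A"
  shows "\<exists>A'\<subseteq>M'. finite A' \<and> (card A = 1 \<longrightarrow> card A' = 1) \<and>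
    alike k M (\<lambda>x. (x \<in> A) # c x) M' (\<lambda>x. (x \<in> A') # c' x)"
proof -
  have "\<exists>T\<subseteq>cell M' c' q. finite T \<and> similar k (A \<inter> cell M c q) T \<and>
      similar k (cell M c q - A) (cell M' c' q - T)" for q
    using similar_split[of k "cell M c q" "cell M' c' q" "A \<inter> cell M c q"] al A
    by (simp add: alike_def Diff_Int_distrib Diff_Int)
  then obtain T where T: "\<And>q. T q \<subseteq> cell M' c' q" "\<And>q. finite (T q)"
    "\<And>q. similar k (A \<inter> cell M c q) (T q)" "\<And>q. similar k (cell M c q - A) (cell M' c' q - T q)"
    by metis
  define A' where "A' = (\<Union>q. T q)"
  \<comment> \<open>Only the finitely many colours occurring in \<open>A\<close> contribute to
    \<open>A'\<close>, which is therefore finite.\<close>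
  have T_empty: "T q = {}" if "q \<notin> c ` A" for q
    using similar_empty_iff[OF T(3)] that by (auto simp: cell_def)
  then have A'_eq: "A' = (\<Union>q\<in>c ` A. T q)" unfolding A'_def by blast
  have mem: "x \<in> A' \<longleftrightarrow> x \<in> T q" if "x \<in> cell M' c' q" for x q
    using that T(1) by (auto simp: A'_def cell_def)
  have "A' \<subseteq> M'" using T(1) by (auto simp: A'_def cell_def)
  moreover have "finite A'" unfolding A'_eq using A(2) T(2) by auto
  moreover have "card A' = 1" if card: "card A = 1"
  proof -
    obtain i where i: "A = {i}" using card card_1_singletonE by blast
    then have "A \<inter> cell M c (c i) = {i}" "A' = T (c i)" using A by (auto simp: cell_def A'_eq)
    then show ?thesis using similar_small[OF T(3)[of "c i"]] by simp
  qed
  moreover have "alike k M (\<lambda>x. (x \<in> A) # c x) M' (\<lambda>x. (x \<in> A') # c' x)"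
    unfolding alike_def
  proof
    fix q :: "bool list"
    show "similar k (cell M (\<lambda>x. (x \<in> A) # c x) q) (cell M' (\<lambda>x. (x \<in> A') # c' x) q)"
    proof (cases q)
      case Nil
      then show ?thesis by (simp add: cell_def similar_def)
    next
      case (Cons b r)
      have "cell M (\<lambda>x. (x \<in> A) # c x) q = (if b then A \<inter> cell M c r else cell M c r - A)"
        using A by (auto simp: Cons cell_def)
      moreover have "cell M' (\<lambda>x. (x \<in> A') # c' x) q = (if b then T r else cell M' c' r - T r)"
        using mem[of _ r] T(1)[of r] by (auto simp: Cons cell_def)
      ultimately show ?thesis using T(3,4) by simp
    qed
  qed
  ultimately show ?thesis by blast
qed

text \<open>The point of the threshold in \<^const>\<open>similar\<close> being at least 2: equality of two points is respected.\<close>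

lemma alike_point:
  assumes al: "alike k M c M' c'" and x: "x \<in> M" "x' \<in> M'" "c x = c' x'" and y': "y' \<in> M'"
  shows "\<exists>y\<in>M. c y = c' y' \<and> (x = y \<longleftrightarrow> x' = y')"
proof (cases "x' = y'")
  case True
  then show ?thesis using x by auto
next
  case False
  let ?C = "cell M c (c' y')" and ?D = "cell M' c' (c' y')"
  have sim: "similar k ?C ?D" using al by (simp add: alike_def)
  have "\<not> ?C \<subseteq> {x}"
  proof
    assume C: "?C \<subseteq> {x}"
    have "?C \<noteq> {}" using similar_empty_iff[OF sim] y' by (auto simp: cell_def)
    then have "?C = {x}" using C by auto
    then have "c x = c' y'" "card ?D = 1" using similar_small[OF sim] by (auto simp: cell_def)
    then have "x' \<in> ?D" "y' \<in> ?D" using x y' by (auto simp: cell_def)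
    with \<open>card ?D = 1\<close> False show False by (metis card_1_singletonE singletonD)
  qed
  then show ?thesis using False by (auto simp: cell_def)
qed

section \<open>Matched sets and the operations of the algebra\<close>

lemma matched_sym:
  "matched M N c d M' N' c' d' a a' \<Longrightarrow> matched M' N' c' d' M N c d a' a"
  unfolding matched_def by metis

text \<open>Orthogonality depends only on which coordinates agree. By \<open>alike_point\<close>,
  each cell of \<open>a'\<close> has a counterpart in \<open>a\<close> that agrees with
  \<open>(i, j)\<close> in the coordinates in which the given cell agrees with
  \<open>(i', j')\<close>.\<close>

lemma matched_perp_half:
  assumes al: "alike k M c M' c'" "alike k N d N' d'" and m: "matched M N c d M' N' c' d' a a'"
    and p: "i \<in> M" "j \<in> N" "i' \<in> M'" "j' \<in> N'" "c i = c' i'" "d j = d' j'"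
    and ij: "(i, j) \<in> perp M N a"
  shows "(i', j') \<in> perp M' N' a'"
proof -
  have "(i' = x') \<noteq> (j' = y')" if xy': "(x', y') \<in> a'" for x' y'
  proof -
    have M': "x' \<in> M'" "y' \<in> N'" using m xy' by (auto simp: matched_def)
    obtain x where x: "x \<in> M" "c x = c' x'" "i = x \<longleftrightarrow> i' = x'"
      using alike_point[OF al(1) p(1,3,5) M'(1)] by blast
    obtain y where y: "y \<in> N" "d y = d' y'" "j = y \<longleftrightarrow> j' = y'"
      using alike_point[OF al(2) p(2,4,6) M'(2)] by blast
    have "(x, y) \<in> a" using m xy' M' x y unfolding matched_def by blast
    then show ?thesis using ij x(3) y(3) by (auto simp: perp_def)
  qed
  then show ?thesis using p(3,4) by (auto simp: perp_def)
qed

lemma matched_perp: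
  assumes al: "alike k M c M' c'" "alike k N d N' d'" and m: "matched M N c d M' N' c' d' a a'"
  shows "matched M N c d M' N' c' d' (perp M N a) (perp M' N' a')"
proof -
  have "(i, j) \<in> perp M N a \<longleftrightarrow> (i', j') \<in> perp M' N' a'"
    if p: "i \<in> M" "j \<in> N" "i' \<in> M'" "j' \<in> N'" "c i = c' i'" "d j = d' j'" for i j i' j'
    using matched_perp_half[OF al m p]
      matched_perp_half[OF al[THEN alike_sym] matched_sym[OF m] p(3,4,1,2) p(5,6)[symmetric]] by blast
  then show ?thesis by (simp add: matched_def perp_subset)
qed

lemma matched_Int:
  assumes "matched M N c d M' N' c' d' a a'" "matched M N c d M' N' c' d' b b'"
  shows "matched M N c d M' N' c' d' (a \<inter> b) (a' \<inter> b')"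
  using assms unfolding matched_def by blast

text \<open>A colour present on one side is present on the other, so each cell of \<open>a'\<close>
  has a counterpart in \<open>a\<close>, where the inclusion can be applied.\<close>

lemma matched_subset_half:
  assumes al: "alike k M c M' c'" "alike k N d N' d'"
    and m: "matched M N c d M' N' c' d' a a'" "matched M N c d M' N' c' d' b b'"
    and sub: "a \<subseteq> b"
  shows "a' \<subseteq> b'"
proof
  fix p assume "p \<in> a'"
  then obtain i' j' where p: "p = (i', j')" "(i', j') \<in> a'" "i' \<in> M'" "j' \<in> N'"
    using m(1) unfolding matched_def by blast
  have "cell M c (c' i') \<noteq> {}" "cell N d (d' j') \<noteq> {}"
    using similar_empty_iff[OF alikeD[OF al(1)], of "c' i'"]
      similar_empty_iff[OF alikeD[OF al(2)], of "d' j'"] p(3,4)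
    by (auto simp: cell_def)
  then obtain i j where "i \<in> M" "c i = c' i'" "j \<in> N" "d j = d' j'" by (auto simp: cell_def)
  then show "p \<in> b'" using m sub p unfolding matched_def by blast
qed

lemma matched_subset_iff:
  assumes "alike k M c M' c'" "alike k N d N' d'"
    and "matched M N c d M' N' c' d' a a'" "matched M N c d M' N' c' d' b b'"
  shows "a \<subseteq> b \<longleftrightarrow> a' \<subseteq> b'"
  using matched_subset_half[OF assms]
    matched_subset_half[OF assms(1,2)[THEN alike_sym] assms(3,4)[THEN matched_sym]] by blast

lemma matched_eq_iff:
  assumes "alike k M c M' c'" "alike k N d N' d'"
    and "matched M N c d M' N' c' d' a a'" "matched M N c d M' N' c' d' b b'"
  shows "a = b \<longleftrightarrow> a' = b'"
  using matched_subset_iff[OF assms] matched_subset_iff[OF assms(1,2,4,3)] by blast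

text \<open>The game invariant. Rows and columns are coloured independently, and the rounds left
  enter only through the threshold in \<open>alike\<close>.\<close>

definition position ::
  "'m set \<Rightarrow> 'n set \<Rightarrow> 'm2 set \<Rightarrow> 'n2 set \<Rightarrow> nat \<Rightarrow> nat set \<Rightarrow>
    (nat \<Rightarrow> ('m \<times> 'n) set) \<Rightarrow> (nat \<Rightarrow> ('m2 \<times> 'n2) set) \<Rightarrow> bool" where
  "position M N M' N' k V e e' \<longleftrightarrow>
     (\<exists>c d c' d'. alike k M c M' c' \<and> alike k N d N' d' \<and>
       (\<forall>n\<in>V. e n \<in> elements M N \<and> e' n \<in> elements M' N' \<and>
          matched M N c d M' N' c' d' (e n) (e' n)))"

lemma position_sym:
  assumes "position M N M' N' k V e e'"
  shows "position M' N' M N k V e' e"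
proof -
  obtain c d c' d' where "alike k M c M' c'" "alike k N d N' d'"
    "\<forall>n\<in>V. e n \<in> elements M N \<and> e' n \<in> elements M' N' \<and> matched M N c d M' N' c' d' (e n) (e' n)"
    using assms unfolding position_def by blast
  then show ?thesis
    unfolding position_def
    by (intro exI[of _ c'] exI[of _ d'] exI[of _ c] exI[of _ d]) (auto intro: alike_sym matched_sym)
qed

text \<open>The new element comes from a strip \<open>A \<times> B\<close>. Its factors refine the
  row and the column colouring, \<open>alike_extend\<close> yields a strip on the other side, and
  the reply is built from that strip in the same way as \<open>a\<close>.\<close>

lemma position_forth:
  assumes pos: "position M N M' N' (Suc k) V e e'" and a: "a \<in> elements M N"
  shows "\<exists>a'\<in>elements M' N'. position M N M' N' k (insert n V) (e(n := a)) (e'(n := a'))"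
proof -
  obtain c d c' d' where al: "alike (Suc k) M c M' c'" "alike (Suc k) N d N' d'"
    and V: "\<forall>n\<in>V. e n \<in> elements M N \<and> e' n \<in> elements M' N' \<and>
      matched M N c d M' N' c' d' (e n) (e' n)"
    using pos unfolding position_def by blast
  obtain F where F: "F \<in> strips M N" and aF: "a = perp M N F \<or> a = perp M N (perp M N F)"
    using a by (auto simp: elements_def)
  obtain A B where AB: "F = A \<times> B" "A \<subseteq> M" "B \<subseteq> N" "finite A" "finite B" "card A = 1 \<or> card B = 1"
    using F by (auto simp: strips_def)
  obtain A' where A': "A' \<subseteq> M'" "finite A'" "card A = 1 \<longrightarrow> card A' = 1"
    and alM: "alike k M (\<lambda>x. (x \<in> A) # c x) M' (\<lambda>x. (x \<in> A') # c' x)" (is "alike k M ?c M' ?c'")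
    using alike_extend[OF al(1) AB(2,4)] by blast
  obtain B' where B': "B' \<subseteq> N'" "finite B'" "card B = 1 \<longrightarrow> card B' = 1"
    and alN: "alike k N (\<lambda>x. (x \<in> B) # d x) N' (\<lambda>x. (x \<in> B') # d' x)" (is "alike k N ?d N' ?d'")
    using alike_extend[OF al(2) AB(3,5)] by blast
  let ?F' = "A' \<times> B'"
  have F': "?F' \<in> strips M' N'" using A' B' AB(6) unfolding strips_def by blast
  have "matched M N ?c ?d M' N' ?c' ?d' F ?F'"
    using A'(1) B'(1) AB(1-3) unfolding matched_def by auto
  note 1 = matched_perp[OF alM alN this]
  note 2 = matched_perp[OF alM alN 1]
  obtain a' where a': "a' \<in> elements M' N'" "matched M N ?c ?d M' N' ?c' ?d' a a'"
    using aF 1 2 F' unfolding elements_def by blast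
  \<comment> \<open>Refined colours determine the old ones, so earlier pairs stay matched.\<close>
  have "matched M N ?c ?d M' N' ?c' ?d' (e m) (e' m)" if "m \<in> V" for m
    using V that unfolding matched_def by simp
  then have "position M N M' N' k (insert n V) (e(n := a)) (e'(n := a'))"
    unfolding position_def using V a a'
    by (intro exI[of _ ?c] exI[of _ ?d] exI[of _ ?c'] exI[of _ ?d'] conjI alM alN) auto
  then show ?thesis using a'(1) by blast
qed

lemma grid_sat_iff:
  assumes sim: "similar k M M'" "similar k N N'"
    and p: "sentence \<sigma> p" "qdepth p \<le> k"
  shows "sat (grid M N) e p \<longleftrightarrow> sat (grid M' N') e' p"
proof (rule back_and_forth[where Z = "position M N M' N'" and V = "{}" and \<sigma> = \<sigma>, OF _ _ _ _ p(2)])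
  show "position M N M' N' k {} e e'" unfolding position_def using alike_const[OF sim(1)] alike_const[OF sim(2)] by blast
next
  fix k V e e' n a
  assume "position M N M' N' (Suc k) V e e'" "a \<in> carrier (grid M N)"
  then show "\<exists>b\<in>carrier (grid M' N'). position M N M' N' k (insert n V) (e(n := a)) (e'(n := b))"
    using position_forth by simp
next
  fix k V e e' n b
  assume "position M N M' N' (Suc k) V e e'" "b \<in> carrier (grid M' N')"
  then show "\<exists>a\<in>carrier (grid M N). position M N M' N' k (insert n V) (e(n := a)) (e'(n := b))"
    using position_forth[OF position_sym] position_sym by (metis grid_simps(1))
next
  fix k V e e' p
  assume "position M N M' N' k V e e'" and p: "atomic p" "fm_fvs p \<subseteq> V"
  then obtain c d c' d' where al: "alike k M c M' c'" "alike k N d N' d'"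
    and V: "\<And>n. n \<in> V \<Longrightarrow> matched M N c d M' N' c' d' (e n) (e' n)"
    unfolding position_def by blast
  let ?m = "matched M N c d M' N' c' d'"
  \<comment> \<open>Terms other than variables all denote \<open>{}\<close>, on both sides.\<close>
  have tm: "?m (tm_val (grid M N) e t) (tm_val (grid M' N') e' t)" if "tm_fvs t \<subseteq> V" for t
    using that V by (cases t) (auto simp: matched_def)
  note perp = matched_perp[OF al] and eq = matched_eq_iff[OF al] and sub = matched_subset_iff[OF al]
  obtain s t u where "p \<in> {Eq s t, J s t u, K s t u}" using p(1) by (auto simp: atomic_def)
  then consider "p = Eq s t" | "p = J s t u" | "p = K s t u" by blast
  then show "sat (grid M N) e p \<longleftrightarrow> sat (grid M' N') e' p"
  proof cases
    case 1
    then show ?thesis using eq[OF tm tm] p(2) by simp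
  next
    case 2
    then have m: "tm_fvs s \<subseteq> V" "tm_fvs t \<subseteq> V" "tm_fvs u \<subseteq> V" using p(2) by auto
    note m = tm[OF m(1)] tm[OF m(2)] tm[OF m(3)]
    show ?thesis
      unfolding 2 sat.simps grid_simps
      using sub[OF m(1) perp[OF m(2)]] eq[OF perp[OF matched_Int[OF perp[OF m(1)] perp[OF m(2)]]] m(3)]
      by simp
  next
    case 3
    then have m: "tm_fvs s \<subseteq> V" "tm_fvs t \<subseteq> V" "tm_fvs u \<subseteq> V" using p(2) by auto
    note m = tm[OF m(1)] tm[OF m(2)] tm[OF m(3)]
    show ?thesis
      unfolding 3 sat.simps grid_simps
      using sub[OF m(2,1)] eq[OF matched_Int[OF m(1) perp[OF m(2)]] m(3)]
      by simp
  qed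
qed (use p(1) in \<open>simp_all add: sentence_def\<close>)

section \<open>Transport to a given type\<close>

text \<open>Sets with \<open>Suc n\<close> elements arise by inserting a point into one with
  \<open>n\<close> elements, so no size exceeds the infinite bound, and there are countably many
  sizes.\<close>

lemma card_of_finite_sets:
  includes cardinal_syntax
  assumes inf: "infinite (UNIV :: 'a set)" and le: "|UNIV :: 'b set| \<le>o |UNIV :: 'a set|"
  shows "|{F :: 'b set. finite F}| \<le>o |UNIV :: 'a set|"
proof -
  have card: "|{F :: 'b set. finite F \<and> card F = n}| \<le>o |UNIV :: 'a set|" for n
  proof (induction n)
    case 0
    have "{F :: 'b set. finite F \<and> card F = 0} = {{}}" by auto
    then show ?case by (intro card_of_ordLeqI[where f = "\<lambda>_. undefined"]) auto
  next
    case (Suc n)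
    let ?U = "\<Union>x :: 'b. insert x ` {F. finite F \<and> card F = n}"
    have "{F :: 'b set. finite F \<and> card F = Suc n} \<subseteq> ?U"
    proof
      fix F :: "'b set" assume "F \<in> {F. finite F \<and> card F = Suc n}"
      then obtain x G where "F = insert x G" "finite G" "card G = n"
        by (auto simp: card_Suc_eq_finite)
      then show "F \<in> ?U" by blast
    qed
    moreover have "|?U| \<le>o |UNIV :: 'a set|"
      using ordLeq_transitive[OF card_of_image Suc]
      by (intro card_of_UNION_ordLeq_infinite[OF inf le] ballI)
    ultimately show ?case by (rule ordLeq_transitive[OF card_of_mono1])
  qed
  have "{F :: 'b set. finite F} = (\<Union>n. {F. finite F \<and> card F = n})" by auto
  moreover have "|\<Union>n. {F :: 'b set. finite F \<and> card F = n}| \<le>o |UNIV :: 'a set|"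
    using inf card by (intro card_of_UNION_ordLeq_infinite[OF inf]) (auto simp: infinite_iff_card_of_nat)
  ultimately show ?thesis by simp
qed

text \<open>Each element is given by a finite set and the choice between its orthocomplement and its
  closure, so even an uncountable grid algebra fits into an infinite type that is as large as the
  grid.\<close>

lemma elements_embedding:
  includes cardinal_syntax
  assumes inf: "infinite (UNIV :: 'a set)" and le: "|UNIV :: ('m \<times> 'n) set| \<le>o |UNIV :: 'a set|"
  obtains g :: "('m \<times> 'n) set \<Rightarrow> 'a" where "inj_on g (elements M N)"
proof -
  let ?F = "{F :: ('m \<times> 'n) set. finite F}"
  have fin: "strips M N \<subseteq> ?F" by (auto simp: strips_def)
  have "elements M N \<subseteq> perp M N ` ?F \<union> (\<lambda>F. perp M N (perp M N F)) ` ?F"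
    using fin unfolding elements_def by blast
  moreover have "|perp M N ` ?F \<union> (\<lambda>F. perp M N (perp M N F)) ` ?F| \<le>o |UNIV :: 'a set|"
    using ordLeq_transitive[OF card_of_image card_of_finite_sets[OF inf le]]
    by (intro card_of_Un_ordLeq_infinite_Field) (simp_all add: inf Field_card_of card_of_card_order_on)
  ultimately have "|elements M N| \<le>o |UNIV :: 'a set|"
    by (rule ordLeq_transitive[OF card_of_mono1])
  then show ?thesis using that card_of_ordLeq[of "elements M N" "UNIV :: 'a set"] by blast
qed

lemma card_of_pairs:
  includes cardinal_syntax
  assumes inf: "infinite (UNIV :: 'a set)" and le: "|UNIV :: 'b set| \<le>o |UNIV :: 'a set|"
  shows "|UNIV :: (nat \<times> 'b) set| \<le>o |UNIV :: 'a set|"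
proof -
  have "|UNIV :: nat set| \<le>o |UNIV :: 'a set|"
    using inf infinite_iff_card_of_nat by blast
  then have "|(UNIV :: nat set) \<times> (UNIV :: 'b set)| \<le>o |UNIV :: 'a set|"
    using le by (intro card_of_Times_ordLeq_infinite_Field) (simp_all add: inf Field_card_of card_of_card_order_on)
  then show ?thesis by simp
qed

lemma exists_third:
  assumes "infinite X \<or> 3 \<le> card X"
  shows "\<exists>z\<in>X. z \<noteq> x \<and> z \<noteq> y"
proof (rule ccontr)
  assume "\<not> ?thesis"
  then have "X \<subseteq> {x, y}" by blast
  moreover have "card {x, y} \<le> 2" by (simp add: card_insert_if)
  ultimately show False using assms card_mono[of "{x, y}" X] finite_subset[of X "{x, y}"] by auto
qed

lemma large_gridI:
  assumes "infinite M \<or> 3 \<le> card M" "infinite N \<or> 3 \<le> card N"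
  shows "large_grid M N"
  using exists_third[OF assms(1)] exists_third[OF assms(2)] by unfold_locales

section \<open>Grid algebras inside the given type\<close>

context
  fixes M :: "'m set" and N :: "'n set" and g :: "('m \<times> 'n) set \<Rightarrow> 'a"
  assumes large: "large_grid M N" and inj: "inj_on g (elements M N)"
begin

lemma iso_grid: "isomorphism \<sigma> (grid M N) (transport g (grid M N)) g"
  using inj by (intro isomorphism_transport) simp

lemma alg_grid: "partial_algebra \<sigma> (transport g (grid M N))"
  by (rule partial_algebra_isomorphism[OF large_grid.partial_algebra_grid[OF large] iso_grid])

lemma models_grid: "sentence \<sigma> p \<Longrightarrow> transport g (grid M N) \<Turnstile> p \<longleftrightarrow> grid M N \<Turnstile> p"
  using isomorphism_models[OF large_grid.partial_algebra_grid[OF large] iso_grid] by blast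

lemma representable_transport:
  assumes "bij_betw h M N"
  shows "representable \<sigma> (transport g (grid M N))"
proof -
  have "representation \<sigma> (transport g (grid M N))
      (\<lambda>a. grid_rep M N (inv_into (carrier (grid M N)) g a))"
    by (intro representation_compose[OF isomorphism_inv[OF large_grid.partial_algebra_grid[OF large] iso_grid]]
        large_grid.representation_grid_rep[OF large assms])
  then show ?thesis by (rule representableI[OF alg_grid])
qed

lemma completely_representable_transport:
  assumes "bij_betw h M N" "DMinus \<in> \<sigma>"
  shows "completely_representable \<sigma> (transport g (grid M N))"
proof -
  have "complete_representation \<sigma> (transport g (grid M N))
      (\<lambda>a. grid_rep M N (inv_into (carrier (grid M N)) g a))"
    by (intro assms(2) large_grid.complete_representation_grid_rep[OF large assms(1)]
        complete_representation_compose[OF isomorphism_inv[OF large_grid.partial_algebra_grid[OF large] iso_grid]])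
  then show ?thesis by (rule completely_representableI[OF alg_grid])
qed

lemma bij_of_representable_finite:
  assumes "representable \<sigma> (transport g (grid M N))" "DMinus \<in> \<sigma>" "finite M" "finite N"
  shows "\<exists>f. bij_betw f M N"
proof -
  obtain \<theta> :: "'a \<Rightarrow> ('a + nat) pfun" where "representation \<sigma> (transport g (grid M N)) \<theta>"
    using assms(1) unfolding representable_def by blast
  then have "representation \<sigma> (grid M N) (\<lambda>a. \<theta> (g a))"
    by (rule representation_compose[OF iso_grid])
  then interpret represented_grid M N \<sigma> "\<lambda>a. \<theta> (g a)"
    using large assms(2) by (simp add: represented_grid_def represented_grid_axioms_def)
  show ?thesis
    using assms(3,4) by (intro bij_of_line_covers finite_line_cover) (auto simp: lines_def)
qed

lemma bij_of_completely_representable: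
  assumes "completely_representable \<sigma> (transport g (grid M N))" "DMinus \<in> \<sigma>"
  shows "\<exists>f. bij_betw f M N"
proof -
  obtain \<theta> :: "'a \<Rightarrow> ('a + nat) pfun" where "complete_representation \<sigma> (transport g (grid M N)) \<theta>"
    using assms(1) unfolding completely_representable_def by blast
  then have c: "complete_representation \<sigma> (grid M N) (\<lambda>a. \<theta> (g a))"
    by (rule complete_representation_compose[OF iso_grid _ assms(2)])
  then interpret represented_grid M N \<sigma> "\<lambda>a. \<theta> (g a)"
    using large assms(2)
    by (simp add: represented_grid_def represented_grid_axioms_def complete_representation_def)
  show ?thesis by (intro bij_of_line_covers complete_line_cover[OF c])
qed

end

section \<open>The two refutations\<close>

lemma not_finitely_axiomatisable:
  assumes \<sigma>: "DMinus \<in> \<sigma>" and inf: "infinite (UNIV :: 'a set)"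
  shows "\<not> finitely_axiomatisable \<sigma> (representable_class \<sigma> :: 'a palg set)"
proof
  assume "finitely_axiomatisable \<sigma> (representable_class \<sigma> :: 'a palg set)"
  then obtain \<Phi> where \<Phi>: "finite \<Phi>" "\<And>p. p \<in> \<Phi> \<Longrightarrow> sentence \<sigma> p"
    and ax: "\<And>A :: 'a palg. partial_algebra \<sigma> A \<Longrightarrow> A \<in> representable_class \<sigma> \<longleftrightarrow> (\<forall>p\<in>\<Phi>. A \<Turnstile> p)"
    unfolding finitely_axiomatisable_def by blast
  obtain k where k: "\<And>p. p \<in> \<Phi> \<Longrightarrow> qdepth p \<le> k"
    using \<Phi>(1) finite_nat_set_iff_bounded_le[of "qdepth ` \<Phi>"] by auto
  \<comment> \<open>Both \<open>m\<close> and \<open>Suc m\<close> exceed the threshold for depth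
    \<open>k\<close>, and the summand 1 ensures three rows even when \<open>k = 0\<close>.\<close>
  define m where "m = 2 ^ Suc k + (1 :: nat)"
  have m: "3 \<le> m" by (simp add: m_def)
  let ?M = "{..<m}" and ?N = "{..<Suc m}"
  have le: "(card_of (UNIV :: (nat \<times> nat) set), card_of (UNIV :: 'a set)) \<in> ordLeq"
    using inf infinite_iff_card_of_nat card_of_pairs by blast
  obtain g :: "(nat \<times> nat) set \<Rightarrow> 'a" where g: "inj_on g (elements ?M ?M)"
    by (rule elements_embedding[OF inf le])
  obtain h :: "(nat \<times> nat) set \<Rightarrow> 'a" where h: "inj_on h (elements ?M ?N)"
    by (rule elements_embedding[OF inf le])
  have large: "large_grid ?M ?M" "large_grid ?M ?N" using m by (auto intro: large_gridI)
  let ?A = "transport g (grid ?M ?M)" and ?B = "transport h (grid ?M ?N)"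
  have "?A \<in> representable_class \<sigma>"
    using alg_grid[OF large(1) g] representable_transport[OF large(1) g bij_betw_id]
    by (simp add: representable_class_def)
  then have A: "?A \<Turnstile> p" if "p \<in> \<Phi>" for p using ax[OF alg_grid[OF large(1) g]] that by blast
  have "similar k ?M ?M" "similar k ?M ?N" by (auto simp: similar_def m_def)
  then have "?B \<Turnstile> p" if "p \<in> \<Phi>" for p
    using A[OF that] grid_sat_iff[OF _ _ \<Phi>(2)[OF that] k[OF that]]
      models_grid[OF large(1) g \<Phi>(2)[OF that]] models_grid[OF large(2) h \<Phi>(2)[OF that]]
    unfolding models_def by blast
  then have "representable \<sigma> ?B" using ax[OF alg_grid[OF large(2) h]] by (auto simp: representable_class_def)
  then obtain f where "bij_betw f ?M ?N"
    using bij_of_representable_finite[OF large(2) h _ \<sigma>] by blast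
  then show False using bij_betw_same_card by fastforce
qed

lemma not_closed_under_elementary_equivalence:
  assumes \<sigma>: "DMinus \<in> \<sigma>" and unc: "uncountable (UNIV :: 'a set)"
  shows "\<not> closed_under_elementary_equivalence \<sigma> (completely_representable_class \<sigma> :: 'a palg set)"
proof
  assume closed: "closed_under_elementary_equivalence \<sigma> (completely_representable_class \<sigma> :: 'a palg set)"
  have inf: "infinite (UNIV :: 'a set)" using unc by (rule uncountable_infinite)
  \<comment> \<open>With \<open>'a\<close> itself as the set of columns there are uncountably many
    of them, and the algebra still embeds into \<open>'a\<close>.\<close>
  let ?M = "UNIV :: nat set" and ?N = "UNIV :: 'a set"
  have le: "(card_of (UNIV :: (nat \<times> nat) set), card_of (UNIV :: 'a set)) \<in> ordLeq"
    using inf infinite_iff_card_of_nat card_of_pairs by blast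
  have le': "(card_of (UNIV :: (nat \<times> 'a) set), card_of (UNIV :: 'a set)) \<in> ordLeq"
    using inf card_of_pairs card_of_mono1 by blast
  obtain g :: "(nat \<times> nat) set \<Rightarrow> 'a" where g: "inj_on g (elements ?M ?M)"
    by (rule elements_embedding[OF inf le])
  obtain h :: "(nat \<times> 'a) set \<Rightarrow> 'a" where h: "inj_on h (elements ?M ?N)"
    by (rule elements_embedding[OF inf le'])
  have large: "large_grid ?M ?M" "large_grid ?M ?N" using inf by (auto intro: large_gridI)
  let ?A = "transport g (grid ?M ?M)" and ?B = "transport h (grid ?M ?N)"
  have "similar k ?M ?M" "similar k ?M ?N" for k using inf by (auto simp: similar_def)
  then have "elementarily_equivalent \<sigma> ?A ?B"
    unfolding elementarily_equivalent_def
    using grid_sat_iff[OF _ _ _ order_refl, where M = ?M and N = ?M and M' = ?M and N' = ?N]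
      models_grid[OF large(1) g] models_grid[OF large(2) h]
    unfolding models_def by blast
  moreover have "?A \<in> completely_representable_class \<sigma>"
    using alg_grid[OF large(1) g] completely_representable_transport[OF large(1) g bij_betw_id \<sigma>]
    by (simp add: completely_representable_class_def)
  ultimately have "completely_representable \<sigma> ?B"
    using closed alg_grid[OF large(1) g] alg_grid[OF large(2) h]
    unfolding closed_under_elementary_equivalence_def completely_representable_class_def by blast
  then obtain f where "bij_betw f ?M ?N"
    using bij_of_completely_representable[OF large(2) h _ \<sigma>] by blast
  then show False using unc by (metis bij_betw_imp_surj_on countableI_type countable_image)
qed

theorem corollary5p14:
  fixes \<sigma> :: "sym set"
  assumes "DMinus \<in> \<sigma>"
    and "uncountable (UNIV :: 'a set)"
  shows "\<not> finitely_axiomatisable \<sigma> (representable_class \<sigma> :: 'a palg set) \<and>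
    \<not> closed_under_elementary_equivalence \<sigma> (completely_representable_class \<sigma> :: 'a palg set)"
  using assms not_finitely_axiomatisable not_closed_under_elementary_equivalence uncountable_infinite
  by blast

end
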